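(* Let $M$ be a connected complex manifold. If $M$ has a bounded continuous strictly plurisubharmonic function, then $M$ is pluri-Greenian. Conversely, if for every $w\in M$ there is a negative continuous plurisubharmonic function $v$ on $M$ with a strict logarithmic pole at $w$, then $M$ has a bounded continuous strictly plurisubharmonic function.
   Context: Plurisubharmonic functions take values in $[-\infty,\infty)$, and the function identically $-\infty$ is regarded as plurisubharmonic; continuity of a function with a pole is understood as continuity with values in $[-\infty,\infty)$. A function $u$ on $M$ has a logarithmic pole at $w\in M$ if $u(z)-\log\|z-w\|$ is bounded above on some coordinate neighborhood of $w$ (the norm being the Euclidean norm in the local coordinates). It has a strict logarithmic pole at $w$ if there are a coordinate neighborhood $U$ of $w$ and constants $c_1,c_2$ such that $\log\|z-w\|+c_1\le u(z)\le \log\|z-w\|+c_2$ for $z\in U$. The pluricomplex Green function of $M$ is $g_M(z,w)=\sup u(z)$ for $z,w\in M$, where the supremum is taken over all negative plurisubharmonic functions $u$ on $M$ with a logarithmic pole at $w$. The manifold $M$ is called pluri-Greenian if for every $w\in M$ the function $z\mapsto g_M(z,w)$ has a strict logarithmic pole at $w$. A plurisubharmonic function $u$ on $M$ is called strictly plurisubharmonic if for every point $w\in M$ there are a coordinate neighborhood $U$ containing $w$ and a number $\varepsilon>0$ such that the function $u(z)-\varepsilon\|z-w\|^2$ is plurisubharmonic on $U$. *)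

theory Defs
  imports "HOL-Analysis.Analysis"
begin

section \<open>Functions with values in $[-\infty,\infty)$\<close>

text \<open>
  Functions with poles have type \<open>_ \<Rightarrow> ereal\<close>; the value \<open>\<infinity>\<close> is excluded where required.
  The library logarithm satisfies \<open>ln 0 = 0\<close>, so the value at 0 has to be set explicitly.
\<close>

definition elog :: "real \<Rightarrow> ereal" where
  "elog x = (if x \<le> 0 then -\<infinity> else ereal (ln x))"

definition usc_on :: "'a::topological_space set \<Rightarrow> ('a \<Rightarrow> ereal) \<Rightarrow> bool" where
  "usc_on S u \<longleftrightarrow>
     (\<forall>x\<in>S. u x < \<infinity>) \<and> (\<forall>c. openin (top_of_set S) {x \<in> S. u x < c})"


section \<open>Subharmonic and plurisubharmonic functions\<close>

text \<open>
  The mean of \<open>u\<close> over the circle of radius \<open>r\<close> about \<open>a\<close>, as the integral of the positive part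
  minus the integral of the negative part (\<open>e2ennreal\<close> sends negative numbers to 0). An upper
  semicontinuous function with values below \<open>\<infinity>\<close> is bounded above on the circle, so the first
  integral is finite and no expression \<open>\<infinity> - \<infinity>\<close> arises.
\<close>

definition circle_mean :: "(complex \<Rightarrow> ereal) \<Rightarrow> complex \<Rightarrow> real \<Rightarrow> ereal" where
  "circle_mean u a r =
     (enn2ereal (\<integral>\<^sup>+t\<in>{0..2*pi}. e2ennreal (u (a + of_real r * cis t)) \<partial>lborel)
      - enn2ereal (\<integral>\<^sup>+t\<in>{0..2*pi}. e2ennreal (- u (a + of_real r * cis t)) \<partial>lborel))
     / ereal (2 * pi)"

text \<open>
  Upper semicontinuity with the local submean inequality. The function identically \<open>-\<infinity>\<close>
  (on all of \<open>D\<close> or on some components) is allowed.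
\<close>

definition subharmonic_on :: "complex set \<Rightarrow> (complex \<Rightarrow> ereal) \<Rightarrow> bool" where
  "subharmonic_on D u \<longleftrightarrow> usc_on D u \<and>
     (\<forall>a\<in>D. \<exists>\<rho>>0. ball a \<rho> \<subseteq> D \<and> (\<forall>r. 0 < r \<and> r < \<rho> \<longrightarrow> u a \<le> circle_mean u a r))"

definition psh_domain :: "(complex^'n) set \<Rightarrow> (complex^'n \<Rightarrow> ereal) \<Rightarrow> bool" where
  "psh_domain \<Omega> u \<longleftrightarrow> usc_on \<Omega> u \<and>
     (\<forall>a b. subharmonic_on {\<zeta>. a + \<zeta> *s b \<in> \<Omega>} (\<lambda>\<zeta>. u (a + \<zeta> *s b)))"


section \<open>Complex manifolds\<close>

text \<open>
  Complex differentiability at every point: the real Frechet derivative exists and is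
  complex linear.
\<close>

definition holomorphic_map_on :: "(complex^'n \<Rightarrow> complex^'n) \<Rightarrow> (complex^'n) set \<Rightarrow> bool" where
  "holomorphic_map_on f \<Omega> \<longleftrightarrow>
     (\<forall>x\<in>\<Omega>. \<exists>D. (f has_derivative D) (at x) \<and> (\<forall>c v. D (c *s v) = c *s D v))"

type_synonym ('m, 'n) chart = "'m set \<times> ('m \<Rightarrow> complex^'n)"

definition is_chart :: "('m::topological_space, 'n::finite) chart \<Rightarrow> bool" where
  "is_chart = (\<lambda>(U, \<phi>). open U \<and> open (\<phi> ` U) \<and> homeomorphism U (\<phi> ` U) \<phi> (inv_into U \<phi>))"

definition compatible :: "('m, 'n::finite) chart \<Rightarrow> ('m, 'n) chart \<Rightarrow> bool" where
  "compatible = (\<lambda>(U, \<phi>) (V, \<psi>).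
     holomorphic_map_on (\<psi> \<circ> inv_into U \<phi>) (\<phi> ` (U \<inter> V)) \<and>
     holomorphic_map_on (\<phi> \<circ> inv_into V \<psi>) (\<psi> ` (U \<inter> V)))"

text \<open>
  The manifold is the whole type \<open>'m\<close>, whose type class provides the Hausdorff property and
  second countability; its dimension is \<open>CARD('n) \<ge> 1\<close>.
\<close>

definition complex_atlas ::
    "('m::{t2_space,second_countable_topology}, 'n::finite) chart set \<Rightarrow> bool" where
  "complex_atlas A \<longleftrightarrow>
     (\<forall>c\<in>A. is_chart c) \<and> (\<Union>c\<in>A. fst c) = UNIV \<and> (\<forall>c\<in>A. \<forall>d\<in>A. compatible c d)"

text \<open>All local coordinate systems of the complex structure given by \<open>A\<close>.\<close>

definition maximal_atlas ::
    "('m::topological_space, 'n::finite) chart set \<Rightarrow> ('m, 'n) chart set" where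
  "maximal_atlas A = {c. is_chart c \<and> (\<forall>d\<in>A. compatible c d)}"


section \<open>Pluripotential theory on a complex manifold\<close>

definition psh_on ::
    "('m::topological_space, 'n::finite) chart set \<Rightarrow> 'm set \<Rightarrow> ('m \<Rightarrow> ereal) \<Rightarrow> bool" where
  "psh_on A W u \<longleftrightarrow>
     (\<forall>(U, \<phi>)\<in>maximal_atlas A. psh_domain (\<phi> ` (U \<inter> W)) (u \<circ> inv_into U \<phi>))"

definition strictly_psh ::
    "('m::topological_space, 'n::finite) chart set \<Rightarrow> ('m \<Rightarrow> ereal) \<Rightarrow> bool" where
  "strictly_psh A u \<longleftrightarrow> psh_on A UNIV u \<and>
     (\<forall>w. \<exists>(U, \<phi>)\<in>maximal_atlas A. w \<in> U \<and>
        (\<exists>\<epsilon>>0. psh_on A U (\<lambda>z. u z - ereal (\<epsilon> * (norm (\<phi> z - \<phi> w))\<^sup>2))))"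

text \<open>
  Boundedness above of \<open>u(z) - log \<parallel>z - w\<parallel>\<close> is written without the subtraction, which is
  indeterminate at \<open>z = w\<close>. In particular \<open>u w = -\<infinity>\<close>.
\<close>

definition log_pole ::
    "('m::topological_space, 'n::finite) chart set \<Rightarrow> ('m \<Rightarrow> ereal) \<Rightarrow> 'm \<Rightarrow> bool" where
  "log_pole A u w \<longleftrightarrow>
     (\<exists>(U, \<phi>)\<in>maximal_atlas A. w \<in> U \<and>
        (\<exists>c::real. \<forall>z\<in>U. u z \<le> elog (norm (\<phi> z - \<phi> w)) + ereal c))"

definition strict_log_pole ::
    "('m::topological_space, 'n::finite) chart set \<Rightarrow> ('m \<Rightarrow> ereal) \<Rightarrow> 'm \<Rightarrow> bool" where
  "strict_log_pole A u w \<longleftrightarrow>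
     (\<exists>(U, \<phi>)\<in>maximal_atlas A. w \<in> U \<and>
        (\<exists>c\<^sub>1 c\<^sub>2 :: real. \<forall>z\<in>U. elog (norm (\<phi> z - \<phi> w)) + ereal c\<^sub>1 \<le> u z \<and>
                             u z \<le> elog (norm (\<phi> z - \<phi> w)) + ereal c\<^sub>2))"

definition pluricomplex_green ::
    "('m::topological_space, 'n::finite) chart set \<Rightarrow> 'm \<Rightarrow> 'm \<Rightarrow> ereal" where
  "pluricomplex_green A z w =
     (SUP u \<in> {u. psh_on A UNIV u \<and> (\<forall>x. u x < 0) \<and> log_pole A u w}. u z)"

definition pluri_greenian :: "('m::topological_space, 'n::finite) chart set \<Rightarrow> bool" where
  "pluri_greenian A \<longleftrightarrow> (\<forall>w. strict_log_pole A (\<lambda>z. pluricomplex_green A z w) w)"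

definition bounded_fun :: "('m \<Rightarrow> ereal) \<Rightarrow> bool" where
  "bounded_fun u \<longleftrightarrow> (\<exists>B::real. \<forall>z. \<bar>u z\<bar> \<le> ereal B)"

end

theory Submission
  imports Defs "HOL-Complex_Analysis.Cauchy_Integral_Formula"
begin

text \<open>
  From a bounded strictly plurisubharmonic \<open>u\<close> one obtains a competitor for the Green function at
  \<open>w\<close> by gluing \<open>log \<rho> + K (u - \<epsilon> \<rho>\<^sup>2)\<close>, \<open>\<rho>\<close> the coordinate distance to \<open>w\<close>, to \<open>K u - C\<close> with a
  maximum; every other competitor is bounded by \<open>log (\<rho> / r)\<close> by the maximum principle on the
  complex lines through \<open>w\<close>. Conversely, if \<open>v\<close> has a strict pole at \<open>w\<close>, then \<open>max v (\<rho>\<^sup>2 - C)\<close>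
  near \<open>w\<close>, continued by \<open>max v (- C)\<close>, is bounded and equals \<open>\<rho>\<^sup>2 - C\<close> close to \<open>w\<close>; countably many
  such functions are summed with weights \<open>2\<^sup>-\<^sup>j\<close>.

  Invariance of plurisubharmonicity under coordinate changes is only needed for the explicit
  functions \<open>\<rho>\<^sup>2\<close> and \<open>log \<rho>\<close>. Along a disc that is a complex line in some chart, these have a
  harmonic minorant touching them at the centre.
\<close>

unbundle no fps_syntax

section \<open>Circle means and the maximum principle\<close>

text \<open>Neither sums nor coordinate changes of general plurisubharmonic functions are immediate
  from the definition: it tests complex lines in every chart of the maximal atlas, and a line of one
  chart is curved in another. So functions are combined in two ways only. Maxima and local agreement
  are harmless for arbitrary values. Sums are formed of continuous real functions, whose circle
  means are additive integrals; at the centre of a pole the value \<open>-\<infinity>\<close> makes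
  the submean inequality void. Squared norms model strictness well because two of them with the same
  leading coefficient and different centres differ by a real-affine function of the coordinates. A
  function that is quadratic on an open set therefore gives strictness at every point of that set,
  and countably many such sets suffice. In the other direction, strict plurisubharmonicity pays for
  the term \<open>- K * \<epsilon> * \<rho>^2\<close>: it makes the logarithmic branch drop below
  the bounded one as \<open>\<rho>\<close> grows, although \<open>log \<rho>\<close>
  increases.\<close>

definition circle_integral :: "(complex \<Rightarrow> real) \<Rightarrow> complex \<Rightarrow> real \<Rightarrow> real" where
  "circle_integral f a r = integral {0..2*pi} (\<lambda>t. f (a + of_real r * cis t))"

lemma circle_point_in_sphere:
  assumes "0 \<le> r"
  shows "a + of_real r * cis t \<in> sphere a r"
  using assms by (simp add: dist_norm norm_mult)

lemma continuous_on_circle: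
  fixes f :: "complex \<Rightarrow> 'b::topological_space"
  assumes "continuous_on (sphere a r) f" "0 \<le> r"
  shows "continuous_on {0..2*pi} (\<lambda>t. f (a + of_real r * cis t))"
  by (rule continuous_on_compose2[OF assms(1)])
     (use circle_point_in_sphere[OF assms(2)] in \<open>auto intro!: continuous_intros\<close>)

text \<open>\<open>e2ennreal\<close> truncates at 0, so the two Lebesgue integrals are those of the
  positive and the negative part. Continuity on the circle makes both finite, and they recombine to
  a single gauge integral, which is linear.\<close>

lemma circle_mean_ereal:
  fixes f :: "complex \<Rightarrow> real"
  assumes "continuous_on (sphere a r) f" "0 \<le> r"
  shows "circle_mean (\<lambda>z. ereal (f z)) a r = ereal (circle_integral f a r / (2*pi))"
proof -
  define h where "h = (\<lambda>t. f (a + of_real r * cis t))"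
  have h: "continuous_on {0..2*pi} h"
    unfolding h_def by (rule continuous_on_circle[OF assms])
  have pos: "enn2ereal (\<integral>\<^sup>+t\<in>{0..2*pi}. e2ennreal (ereal (k t)) \<partial>lborel)
      = ereal (integral {0..2*pi} (\<lambda>t. max 0 (k t)))"
    if k: "continuous_on {0..2*pi} k" for k :: "real \<Rightarrow> real"
  proof -
    have "(\<lambda>t. max 0 (k t)) integrable_on {0..2*pi}"
      by (intro integrable_continuous_real continuous_intros k)
    then have I: "((\<lambda>t. max 0 (k t)) has_integral integral {0..2*pi} (\<lambda>t. max 0 (k t))) {0..2*pi}"
      by blast
    have "(\<integral>\<^sup>+t\<in>{0..2*pi}. e2ennreal (ereal (k t)) \<partial>lborel)
        = (\<integral>\<^sup>+t. ennreal (max 0 (k t)) * indicator {0..2*pi} t \<partial>lborel)"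
      by (intro nn_integral_cong) (simp add: ennreal_max_0)
    also have "\<dots> = ennreal (integral {0..2*pi} (\<lambda>t. max 0 (k t)))"
      by (rule nn_integral_has_integral_lebesgue'[OF _ I]) simp
    finally show ?thesis
      using has_integral_nonneg[OF I] by (simp add: enn2ereal_ennreal)
  qed
  have nh: "continuous_on {0..2*pi} (\<lambda>t. - h t)"
    by (intro continuous_intros h)
  have "integral {0..2*pi} (\<lambda>t. max 0 (h t)) - integral {0..2*pi} (\<lambda>t. max 0 (- h t))
      = integral {0..2*pi} (\<lambda>t. max 0 (h t) - max 0 (- h t))"
    by (intro Henstock_Kurzweil_Integration.integral_diff[symmetric] integrable_continuous_real
        continuous_intros h)
  also have "(\<lambda>t. max 0 (h t) - max 0 (- h t)) = h"
    by (auto simp: max_def)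
  finally have "integral {0..2*pi} (\<lambda>t. max 0 (h t)) - integral {0..2*pi} (\<lambda>t. max 0 (- h t))
      = integral {0..2*pi} h" .
  then show ?thesis
    using pos[OF h] pos[OF nh] unfolding circle_mean_def circle_integral_def h_def by simp
qed

text \<open>Holds without measurability, since \<open>nn_integral\<close> is monotone for arbitrary
  functions.\<close>

lemma circle_mean_mono:
  assumes "\<And>z. z \<in> sphere a r \<Longrightarrow> u z \<le> v z" "0 \<le> r"
  shows "circle_mean u a r \<le> circle_mean v a r"
proof -
  have "u (a + of_real r * cis t) \<le> v (a + of_real r * cis t)" for t
    using assms circle_point_in_sphere by blast
  then show ?thesis
    unfolding circle_mean_def
    by (intro ereal_divide_right_mono ereal_minus_mono)
       (auto intro!: nn_integral_mono mult_right_mono e2ennreal_mono simp flip: less_eq_ennreal.rep_eq)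
qed

lemma circle_integral_mono:
  assumes "continuous_on (sphere a r) f" "continuous_on (sphere a r) g" "0 \<le> r"
    "\<And>z. z \<in> sphere a r \<Longrightarrow> f z \<le> g z"
  shows "circle_integral f a r \<le> circle_integral g a r"
  unfolding circle_integral_def using assms circle_point_in_sphere
  by (intro integral_le integrable_continuous_real continuous_on_circle) auto

lemma circle_integral_add:
  assumes "continuous_on (sphere a r) f" "continuous_on (sphere a r) g" "0 \<le> r"
  shows "circle_integral (\<lambda>z. f z + g z) a r = circle_integral f a r + circle_integral g a r"
  unfolding circle_integral_def using assms
  by (intro Henstock_Kurzweil_Integration.integral_add integrable_continuous_real continuous_on_circle) auto

lemma circle_integral_const: "circle_integral (\<lambda>z. c) a r = 2 * pi * c"
  by (simp add: circle_integral_def)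

lemma circle_integral_cmult: "circle_integral (\<lambda>z. c * f z) a r = c * circle_integral f a r"
  by (simp add: circle_integral_def)

text \<open>The mean value property: in Cauchy's formula at the centre, the factor
  \<open>r * cis t\<close> from the derivative of the parametrisation cancels the denominator
  \<open>u - a\<close>.\<close>

lemma circle_integral_Re_holomorphic:
  assumes g: "g holomorphic_on ball a \<rho>" and r: "0 < r" "r < \<rho>"
  shows "circle_integral (\<lambda>z. Re (g z)) a r = 2 * pi * Re (g a)"
proof -
  have "g holomorphic_on cball a r"
    by (rule holomorphic_on_subset[OF g]) (use r in auto)
  then have "((\<lambda>u. g u/(u-a)) has_contour_integral (2 * of_real pi * \<i> * g a)) (circlepath a r)"
    using r by (intro Cauchy_integral_circlepath_simple) auto
  then have "((\<lambda>t. g (a + r * cis t) / (a + r * cis t - a) * r * \<i> * cis t)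
      has_integral (2 * of_real pi * \<i> * g a)) {0..2*pi}"
    unfolding circlepath_def by (subst (asm) has_contour_integral_part_circlepath_iff) auto
  then have "((\<lambda>t. \<i> * g (a + r * cis t)) has_integral (2 * of_real pi * \<i> * g a)) {0..2*pi}"
    by (rule has_integral_eq[rotated]) (use r in \<open>simp add: field_simps\<close>)
  from has_integral_mult_right[OF this, of "-\<i>"]
  have "((\<lambda>t. g (a + r * cis t)) has_integral (2 * of_real pi * g a)) {0..2*pi}"
    by (rule has_integral_eq_rhs[OF has_integral_eq[rotated]]) (simp_all add: algebra_simps)
  from has_integral_Re[OF this] show ?thesis
    unfolding circle_integral_def by (simp add: integral_unique)
qed

section \<open>Upper semicontinuity and the maximum principle\<close>

text \<open>Without a maximum the open sublevel sets \<open>u x < u y\<close>, for \<open>y\<close>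
  in \<open>K\<close>, cover \<open>K\<close>. In a finite subcover the \<open>y\<close> with the
  largest \<open>u y\<close> is itself uncovered.\<close>

lemma usc_on_attains_max:
  fixes u :: "'a::topological_space \<Rightarrow> ereal"
  assumes "compact K" "K \<noteq> {}" "usc_on K u"
  shows "\<exists>p\<in>K. \<forall>x\<in>K. u x \<le> u p"
proof (rule ccontr)
  assume "\<not> ?thesis"
  then have ex: "\<forall>p\<in>K. \<exists>x\<in>K. u p < u x"
    by (auto simp: not_le)
  have "\<exists>T. open T \<and> {x\<in>K. u x < c} = K \<inter> T" for c
    using assms(3) unfolding usc_on_def openin_open by blast
  then obtain T where T: "\<And>c. open (T c)" "\<And>c. {x\<in>K. u x < c} = K \<inter> T c"
    by metis
  have "K \<subseteq> (\<Union>y\<in>K. T (u y))"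
    using ex T(2) by blast
  then obtain F where F: "F \<subseteq> K" "finite F" "K \<subseteq> (\<Union>y\<in>F. T (u y))"
    using compactE_image[OF assms(1)] T(1) by metis
  with assms(2) have "F \<noteq> {}" by auto
  have "Max (u ` F) \<in> u ` F"
    using F(2) \<open>F \<noteq> {}\<close> by simp
  then obtain y where y: "y \<in> F" "u y = Max (u ` F)" by auto
  then obtain y' where "y' \<in> F" "u y < u y'"
    using F T(2) by blast
  moreover have "u y' \<le> Max (u ` F)"
    using F(2) \<open>y' \<in> F\<close> by simp
  ultimately show False
    using y by simp
qed

text \<open>The punctured filter suffices because \<open>u x < c\<close> is already known at the
  point itself.\<close>

lemma usc_on_pointwise:
  fixes u :: "'a::topological_space \<Rightarrow> ereal"
  shows "usc_on S u \<longleftrightarrow>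
    (\<forall>x\<in>S. u x < \<infinity> \<and> (\<forall>c>u x. eventually (\<lambda>y. u y < c) (at x within S)))"
proof -
  have *: "openin (top_of_set S) {x \<in> S. u x < c} \<longleftrightarrow>
      (\<forall>x\<in>S. u x < c \<longrightarrow> eventually (\<lambda>y. u y < c) (at x within S))" for c
  proof
    assume "openin (top_of_set S) {x \<in> S. u x < c}"
    then obtain T where T: "open T" "{x \<in> S. u x < c} = S \<inter> T"
      by (auto simp: openin_open)
    then show "\<forall>x\<in>S. u x < c \<longrightarrow> eventually (\<lambda>y. u y < c) (at x within S)"
      unfolding eventually_at_topological by blast
  next
    assume R: "\<forall>x\<in>S. u x < c \<longrightarrow> eventually (\<lambda>y. u y < c) (at x within S)"
    show "openin (top_of_set S) {x \<in> S. u x < c}"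
    proof (subst openin_subopen, intro ballI)
      fix x assume x: "x \<in> {x \<in> S. u x < c}"
      then have "eventually (\<lambda>y. u y < c) (at x within S)"
        using R by simp
      then obtain T where T: "open T" "x \<in> T" "\<forall>y\<in>T. y \<noteq> x \<longrightarrow> y \<in> S \<longrightarrow> u y < c"
        unfolding eventually_at_topological by auto
      have "openin (top_of_set S) (S \<inter> T)"
        using T(1) by (rule openin_open_Int)
      moreover have "S \<inter> T \<subseteq> {x \<in> S. u x < c}"
        using x T(3) by auto
      ultimately show "\<exists>T. openin (top_of_set S) T \<and> x \<in> T \<and> T \<subseteq> {x \<in> S. u x < c}"
        using x T(2) by (intro exI[of _ "S \<inter> T"]) simp
    qed
  qed
  show ?thesis
    unfolding usc_on_def * by blast
qed

lemma usc_on_subset: "usc_on D u \<Longrightarrow> K \<subseteq> D \<Longrightarrow> usc_on K u"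
  unfolding usc_on_pointwise by (meson at_le filter_leD subsetD)

lemma usc_on_add_continuous:
  fixes u :: "'a::topological_space \<Rightarrow> ereal"
  assumes "usc_on S u" "continuous_on S h"
  shows "usc_on S (\<lambda>x. u x + ereal (h x))"
  unfolding usc_on_pointwise
proof (intro ballI conjI allI impI)
  fix x assume x: "x \<in> S"
  then have fin: "u x < \<infinity>" using assms(1) by (simp add: usc_on_def)
  then show "u x + ereal (h x) < \<infinity>" by simp
  fix c assume c: "u x + ereal (h x) < c"
  then obtain c' where c': "u x + ereal (h x) < ereal c'" "ereal c' < c"
    using ereal_dense2 by blast
  then have "u x < ereal (c' - h x)"
    by (cases "u x") auto
  \<comment> \<open>\<open>d\<close> divides the available gap: it is enough that \<open>u\<close>
    stays below \<open>d\<close> and \<open>h\<close> below \<open>c' - d\<close>.\<close>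
  then obtain d where d: "u x < ereal d" "ereal d < ereal (c' - h x)"
    using ereal_dense2 by blast
  have "eventually (\<lambda>y. u y < ereal d) (at x within S)"
    using assms(1) x d(1) unfolding usc_on_pointwise by blast
  moreover have "eventually (\<lambda>y. h y < c' - d) (at x within S)"
    using assms(2) x d(2)
    by (intro order_tendstoD(2)[where y="h x"]) (auto simp: continuous_on_def)
  ultimately show "eventually (\<lambda>y. u y + ereal (h y) < c) (at x within S)"
  proof eventually_elim
    case (elim y)
    then have "u y + ereal (h y) < ereal c'"
      by (cases "u y") auto
    then show ?case using c'(2) by (rule less_trans)
  qed
qed

text \<open>
  An interior maximum of \<open>u - h + \<epsilon> |z|\<^sup>2\<close> is impossible, because on small circles
  about \<open>p\<close> the function \<open>|z|\<^sup>2\<close> has mean \<open>|p|\<^sup>2 + r\<^sup>2\<close>.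
\<close>

lemma maximum_principle:
  assumes u: "subharmonic_on D u" and K: "compact K" "K \<subseteq> D"
    and h: "continuous_on K h"
    and harm: "\<And>a. a \<in> interior K \<Longrightarrow>
      \<exists>\<rho>>0. \<exists>g. g holomorphic_on ball a \<rho> \<and> (\<forall>z\<in>ball a \<rho>. h z = Re (g z))"
    and bd: "\<And>z. z \<in> frontier K \<Longrightarrow> u z \<le> ereal (h z)"
    and z0: "z0 \<in> K"
  shows "u z0 \<le> ereal (h z0)"
proof (rule ccontr)
  assume neg: "\<not> u z0 \<le> ereal (h z0)"
  have uD: "usc_on D u" using u by (simp add: subharmonic_on_def)
  then have "u z0 < \<infinity>" using z0 K by (auto simp: usc_on_def)
  with neg obtain y0 where y0: "u z0 = ereal y0" "y0 > h z0"
    by (cases "u z0") auto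
  define \<kappa> where "\<kappa> = y0 - h z0"
  have "\<kappa> > 0" using y0 by (simp add: \<kappa>_def)
  obtain R where R: "R > 0" "\<And>z. z \<in> K \<Longrightarrow> norm z \<le> R"
    using compact_imp_bounded[OF K(1)] bounded_pos by blast
  \<comment> \<open>Keeps \<open>\<epsilon> * (norm z)^2\<close> below the excess
    \<open>\<kappa>\<close> throughout \<open>K\<close>. On the frontier \<open>s\<close> is then
    less than \<open>\<kappa> \<le> s z0\<close>, which forces the maximum into the
    interior.\<close>
  define \<epsilon> where "\<epsilon> = \<kappa> / (2 * R\<^sup>2)"
  have \<epsilon>: "\<epsilon> > 0" "\<epsilon> * R\<^sup>2 < \<kappa>"
    using \<open>\<kappa> > 0\<close> R by (auto simp: \<epsilon>_def)
  define s where "s = (\<lambda>z. u z + ereal (\<epsilon> * (norm z)\<^sup>2 - h z))"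
  have "usc_on K s"
    unfolding s_def
    by (intro usc_on_add_continuous usc_on_subset[OF uD K(2)] continuous_intros h)
  then obtain p where p: "p \<in> K" "\<And>x. x \<in> K \<Longrightarrow> s x \<le> s p"
    using usc_on_attains_max[OF K(1)] z0 by blast
  have "u p < \<infinity>" using uD p K by (auto simp: usc_on_def)
  have "ereal \<kappa> \<le> s z0"
    using \<epsilon> by (simp add: s_def y0 \<kappa>_def)
  also have "\<dots> \<le> s p" using p z0 by blast
  finally have sp: "ereal \<kappa> \<le> s p" .
  with \<open>u p < \<infinity>\<close> obtain y where y: "u p = ereal y"
    by (cases "u p") (auto simp: s_def)
  have "p \<notin> frontier K"
  proof
    assume "p \<in> frontier K"
    then have "y \<le> h p" using bd[of p] y by simp
    moreover have "\<epsilon> * (norm p)\<^sup>2 \<le> \<epsilon> * R\<^sup>2"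
      using R(2)[OF p(1)] \<epsilon> by (intro mult_left_mono power_mono) auto
    moreover have "\<kappa> \<le> y + (\<epsilon> * (norm p)\<^sup>2 - h p)"
      using sp by (simp add: s_def y)
    ultimately show False
      using \<epsilon>(2) by linarith
  qed
  then have pint: "p \<in> interior K"
    using p K(1) by (simp add: frontier_def compact_imp_closed)
  then obtain \<rho>1 g where g: "\<rho>1 > 0" "g holomorphic_on ball p \<rho>1" "\<And>z. z \<in> ball p \<rho>1 \<Longrightarrow> h z = Re (g z)"
    using harm by blast
  obtain \<rho>2 where \<rho>2: "\<rho>2 > 0" "\<And>r. 0 < r \<Longrightarrow> r < \<rho>2 \<Longrightarrow> u p \<le> circle_mean u p r"
    using u p K unfolding subharmonic_on_def by blast
  obtain \<rho>3 where \<rho>3: "\<rho>3 > 0" "ball p \<rho>3 \<subseteq> K"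
    using pint by (auto simp: mem_interior)
  define r where "r = Min {\<rho>1, \<rho>2, \<rho>3} / 2"
  have r: "0 < r" "r < \<rho>1" "r < \<rho>2" "r < \<rho>3"
    using g \<rho>2 \<rho>3 by (auto simp: r_def)
  define C where "C = y + \<epsilon> * (norm p)\<^sup>2 - h p"
  \<comment> \<open>On the circle \<open>|z - p| = r\<close> the function \<open>(norm z)^2\<close>
    equals the real part of an affine holomorphic function. So \<open>Re G\<close> coincides there
    with the upper bound \<open>C + h z - \<epsilon> * (norm z)^2\<close> of \<open>u\<close>, while
    at \<open>p\<close> it takes the smaller value \<open>y - \<epsilon> * r^2\<close>.\<close>
  define G where "G = (\<lambda>z. complex_of_real C + g z
      - of_real \<epsilon> * (of_real (r\<^sup>2 + (norm p)\<^sup>2) + 2 * cnj p * (z - p)))"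
  have Ghol: "G holomorphic_on ball p \<rho>1"
    unfolding G_def by (intro holomorphic_intros g)
  have "u z \<le> ereal (Re (G z))" if z: "z \<in> sphere p r" for z
  proof -
    have zK: "z \<in> K" and zb: "z \<in> ball p \<rho>1"
      using z r \<rho>3 by (auto simp: subset_iff)
    have "s z \<le> ereal C"
      using p(2)[OF zK] by (simp add: s_def y C_def add_diff_eq)
    moreover have "u z < \<infinity>" using uD zK K by (auto simp: usc_on_def)
    ultimately have "u z \<le> ereal (C + h z - \<epsilon> * (norm z)\<^sup>2)"
      by (cases "u z") (auto simp: s_def)
    moreover have "(norm z)\<^sup>2 = r\<^sup>2 + (norm p)\<^sup>2 + 2 * Re (cnj p * (z - p))"
    proof -
      have "r\<^sup>2 = (norm (z - p))\<^sup>2"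
        using z by (simp add: dist_norm norm_minus_commute)
      then show ?thesis
        unfolding cmod_power2 by (simp add: power2_eq_square algebra_simps)
    qed
    ultimately show ?thesis
      using g(3)[OF zb] by (simp add: G_def mult.assoc)
  qed
  then have "circle_mean u p r \<le> circle_mean (\<lambda>z. ereal (Re (G z))) p r"
    using r by (intro circle_mean_mono) auto
  also have "\<dots> = ereal (Re (G p))"
  proof -
    have "continuous_on (sphere p r) (\<lambda>z. Re (G z))"
      by (intro continuous_intros continuous_on_subset[OF holomorphic_on_imp_continuous_on[OF Ghol]])
         (use r in auto)
    then show ?thesis
      using r by (simp add: circle_mean_ereal circle_integral_Re_holomorphic[OF Ghol])
  qed
  also have "Re (G p) = y - \<epsilon> * r\<^sup>2"
    using g(3)[of p] g(1) by (simp add: G_def C_def algebra_simps)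
  finally have "u p \<le> ereal (y - \<epsilon> * r\<^sup>2)"
    using \<rho>2(2)[of r] r by simp
  then show False
    using y \<epsilon> r by (simp add: mult_le_0_iff)
qed

section \<open>Approximation on circles by real parts of entire functions\<close>

text \<open>Restricted to the unit circle these are exactly the real trigonometric polynomials.\<close>

inductive trig :: "(complex \<Rightarrow> real) \<Rightarrow> bool" where
  trig_base: "trig (\<lambda>z. Re (c * z^n * cnj z^m))"
| trig_add: "trig f \<Longrightarrow> trig g \<Longrightarrow> trig (\<lambda>z. f z + g z)"

text \<open>The product-to-sum formula
  \<open>Re A * Re B = Re (A * B / 2) + Re (A * cnj B / 2)\<close>: conjugating \<open>B\<close>
  swaps its two exponents, so both summands have the basic form again.\<close>

lemma trig_mult:
  assumes "trig f" "trig g"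
  shows "trig (\<lambda>z. f z * g z)"
  using assms
proof (induction f rule: trig.induct)
  case (trig_base c n m)
  then show ?case
  proof (induction g rule: trig.induct)
    case (trig_base d k l)
    have eq: "Re A * Re B = Re (A * B / 2) + Re (A * cnj B / 2)" for A B
      by (simp add: field_simps)
    have "trig (\<lambda>z. Re (c * d / 2 * z^(n+k) * cnj z^(m+l)) + Re (c * cnj d / 2 * z^(n+l) * cnj z^(m+k)))"
      by (intro trig.intros)
    also have "(\<lambda>z. Re (c * d / 2 * z^(n+k) * cnj z^(m+l)) + Re (c * cnj d / 2 * z^(n+l) * cnj z^(m+k)))
       = (\<lambda>z. Re (c * z^n * cnj z^m) * Re (d * z^k * cnj z^l))"
      unfolding eq by (intro ext) (simp add: power_add mult_ac)
    finally show ?case .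
  next
    case (trig_add f g)
    then show ?case
      unfolding distrib_left by (intro trig.trig_add)
  qed
next
  case (trig_add f g)
  then show ?case
    unfolding distrib_right by (intro trig.trig_add) auto
qed

lemma trig_continuous: "trig f \<Longrightarrow> continuous_on S f"
  by (induction rule: trig.induct) (auto intro!: continuous_intros)

text \<open>On the unit circle \<open>z * cnj z = 1\<close> cancels the smaller exponent. A
  remaining power of \<open>cnj z\<close> is turned into one of \<open>z\<close> by conjugating,
  which leaves the real part unchanged.\<close>

lemma trig_Re_holomorphic:
  assumes "trig f"
  shows "\<exists>p. p holomorphic_on UNIV \<and> (\<forall>z\<in>sphere 0 1. f z = Re (p z))"
  using assms
proof (induction rule: trig.induct)
  case (trig_base c n m)
  have *: "z * cnj z = 1" if "z \<in> sphere 0 1" for z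
    using that by (simp add: complex_mult_cnj cmod_power2[symmetric])
  show ?case
  proof (cases "m \<le> n")
    case True
    have "z ^ n * cnj z ^ m = z ^ (n - m)" if "z \<in> sphere 0 1" for z
    proof -
      have "z ^ n = z ^ (n - m) * z ^ m"
        using True by (simp flip: power_add)
      then have "z ^ n * cnj z ^ m = z ^ (n - m) * (z * cnj z) ^ m"
        unfolding power_mult_distrib by simp
      then show ?thesis using *[OF that] by simp
    qed
    then show ?thesis
      by (intro exI[of _ "\<lambda>z. c * z^(n-m)"]) (auto intro!: holomorphic_intros simp: mult.assoc)
  next
    case False
    have "Re (c * (z ^ n * cnj z ^ m)) = Re (cnj c * z ^ (m - n))" if "z \<in> sphere 0 1" for z
    proof -
      have "cnj z ^ m = cnj z ^ (m - n) * cnj z ^ n"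
        using False by (simp flip: power_add)
      then have "z ^ n * cnj z ^ m = cnj z ^ (m - n) * (z * cnj z) ^ n"
        unfolding power_mult_distrib by simp
      then have "c * (z ^ n * cnj z ^ m) = cnj (cnj c * z ^ (m - n))" using *[OF that] by simp
      then show ?thesis by (simp only: cnj.sel)
    qed
    then show ?thesis
      by (intro exI[of _ "\<lambda>z. cnj c * z^(m-n)"]) (auto intro!: holomorphic_intros simp: mult.assoc)
  qed
next
  case (trig_add f g)
  then obtain p q where "p holomorphic_on UNIV" "\<forall>z\<in>sphere 0 1. f z = Re (p z)"
    "q holomorphic_on UNIV" "\<forall>z\<in>sphere 0 1. g z = Re (q z)" by auto
  then show ?case
    by (intro exI[of _ "\<lambda>z. p z + q z"]) (auto intro!: holomorphic_intros)
qed

lemma trig_ring: "function_ring_on {f. trig f} (sphere (0::complex) 1)"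
proof
  show "(\<lambda>_. c) \<in> {f. trig f}" for c
    using trig_base[of "of_real c" 0 0] by simp
  show "\<exists>f\<in>{f. trig f}. f x \<noteq> f y" if "x \<noteq> y" for x y :: complex
    \<comment> \<open>The two instances are \<open>Re z\<close> and \<open>Im z\<close>, which
      together separate points.\<close>
    using trig_base[of 1 1 0] trig_base[of "-\<i>" 1 0] that
    by (auto simp: complex_eq_iff)
qed (auto intro: trig_continuous trig_add trig_mult)

text \<open>Stone--Weierstrass transported from the unit circle. As \<open>p\<close> is entire,
  \<open>Re p\<close> is harmonic on the whole disc: an approximate solution of the Dirichlet
  problem with boundary values \<open>f\<close>.\<close>

lemma circle_approx_Re_holomorphic:
  fixes f :: "complex \<Rightarrow> real"
  assumes f: "continuous_on (sphere a r) f" and r: "r > 0" and e: "e > 0"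
  shows "\<exists>p. p holomorphic_on UNIV \<and> (\<forall>z\<in>sphere a r. \<bar>f z - Re (p z)\<bar> < e)"
proof -
  interpret function_ring_on "{f. trig f}" "sphere (0::complex) 1"
    by (rule trig_ring)
  have "continuous_on (sphere 0 1) (\<lambda>w. f (a + of_real r * w))"
    by (rule continuous_on_compose2[OF f])
       (use r in \<open>auto intro!: continuous_intros simp: dist_norm norm_mult\<close>)
  then obtain g where g: "trig g" "\<forall>w\<in>sphere 0 1. \<bar>f (a + of_real r * w) - g w\<bar> < e"
    using Stone_Weierstrass_basic[OF _ e] by blast
  then obtain p where p: "p holomorphic_on UNIV" "\<forall>z\<in>sphere 0 1. g z = Re (p z)"
    using trig_Re_holomorphic by blast
  have "\<bar>f z - Re (p ((z - a) / of_real r))\<bar> < e" if "z \<in> sphere a r" for z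
  proof -
    have "(z - a) / of_real r \<in> sphere 0 1"
      using that r by (simp add: dist_norm norm_divide norm_minus_commute)
    moreover have "a + of_real r * ((z - a) / of_real r) = z"
      using r by simp
    ultimately show ?thesis
      using g(2) p(2) by metis
  qed
  moreover have "(\<lambda>z. p ((z - a) / of_real r)) holomorphic_on UNIV"
    by (rule holomorphic_on_compose_gen[OF _ p(1), unfolded o_def])
       (use r in \<open>auto intro!: holomorphic_intros\<close>)
  ultimately show ?thesis by blast
qed

text \<open>
  The definition of subharmonicity only speaks about small circles, but an infinite sum needs a
  radius common to all terms. Stone--Weierstrass and the maximum principle take the place of the
  Poisson integral.
\<close>

lemma subharmonic_on_submean_circle:
  fixes f :: "complex \<Rightarrow> real"
  assumes u: "subharmonic_on D (\<lambda>z. ereal (f z))" and D: "cball a r \<subseteq> D"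
    and f: "continuous_on (sphere a r) f" and r: "r > 0"
  shows "2 * pi * f a \<le> circle_integral f a r"
proof (rule field_le_epsilon)
  fix e' :: real assume "e' > 0"
  \<comment> \<open>The error \<open>e\<close> enters twice, when passing from \<open>f\<close> to
    \<open>Re p\<close> and back, each time with weight \<open>2 * pi\<close>.\<close>
  define e where "e = e' / (4 * pi)"
  have "e > 0" using \<open>e' > 0\<close> by (simp add: e_def)
  obtain p where p: "p holomorphic_on UNIV" "\<And>z. z \<in> sphere a r \<Longrightarrow> \<bar>f z - Re (p z)\<bar> < e"
    using circle_approx_Re_holomorphic[OF f r \<open>e > 0\<close>] by blast
  have pc: "continuous_on S p" for S
    using p(1) holomorphic_on_imp_continuous_on holomorphic_on_subset by blast
  \<comment> \<open>\<open>Re p + e\<close> is harmonic and dominates \<open>f\<close> on the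
    circle, hence also at the centre.\<close>
  have "ereal (f a) \<le> ereal (Re (p a) + e)"
  proof (rule maximum_principle[OF u _ D])
    show "continuous_on (cball a r) (\<lambda>z. Re (p z) + e)"
      by (intro continuous_intros pc)
    show "\<exists>\<rho>>0. \<exists>g. g holomorphic_on ball b \<rho> \<and> (\<forall>z\<in>ball b \<rho>. Re (p z) + e = Re (g z))"
      if "b \<in> interior (cball a r)" for b
      by (intro exI[of _ 1] conjI exI[of _ "\<lambda>z. p z + of_real e"] holomorphic_intros
          holomorphic_on_subset[OF p(1)]) auto
    show "ereal (f z) \<le> ereal (Re (p z) + e)" if "z \<in> frontier (cball a r)" for z
      using p(2)[of z] that r by (auto simp: frontier_cball)
  qed (use r in auto)
  then have "2 * pi * f a \<le> 2 * pi * (Re (p a) + e)"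
    by simp
  also have "\<dots> = circle_integral (\<lambda>z. Re (p z)) a r + 2 * pi * e"
    using circle_integral_Re_holomorphic[OF holomorphic_on_subset[OF p(1)], of a "r+1" r] r
    by (simp add: algebra_simps)
  also have "circle_integral (\<lambda>z. Re (p z)) a r \<le> circle_integral (\<lambda>z. f z + e) a r"
    using r p(2) by (intro circle_integral_mono continuous_intros pc f) (auto simp: abs_less_iff algebra_simps intro: less_imp_le)
  also have "\<dots> = circle_integral f a r + 2 * pi * e"
    using r by (subst circle_integral_add) (auto intro!: continuous_intros f simp: circle_integral_const)
  finally show "2 * pi * f a \<le> circle_integral f a r + e'"
    by (simp add: e_def)
qed

section \<open>Plurisubharmonicity as a property of germs\<close>

lemma circle_mean_cong:
  assumes "\<And>z. z \<in> sphere a r \<Longrightarrow> u z = v z" "0 \<le> r"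
  shows "circle_mean u a r = circle_mean v a r"
  using assms by (intro antisym circle_mean_mono) auto

lemma usc_on_compose:
  assumes "usc_on S u" "continuous_on T f" "f ` T \<subseteq> S"
  shows "usc_on T (u \<circ> f)"
  unfolding usc_on_def
proof (intro conjI ballI allI)
  show "(u \<circ> f) x < \<infinity>" if "x \<in> T" for x
    using assms that by (auto simp: usc_on_def)
  fix c
  have "openin (top_of_set S) {x \<in> S. u x < c}"
    using assms(1) by (simp add: usc_on_def)
  then have "openin (top_of_set T) (T \<inter> f -` {x \<in> S. u x < c})"
    using assms(2,3) by (intro continuous_openin_preimage) auto
  moreover have "T \<inter> f -` {x \<in> S. u x < c} = {x \<in> T. (u \<circ> f) x < c}"
    using assms(3) by auto
  ultimately show "openin (top_of_set T) {x \<in> T. (u \<circ> f) x < c}"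
    by simp
qed

lemma usc_on_open_iff:
  fixes u :: "'a::topological_space \<Rightarrow> ereal"
  assumes "open S"
  shows "usc_on S u \<longleftrightarrow>
    (\<forall>x\<in>S. u x < \<infinity> \<and> (\<forall>c>u x. eventually (\<lambda>y. u y < c) (nhds x)))"
proof -
  have "eventually (\<lambda>y. u y < c) (at x within S) \<longleftrightarrow> eventually (\<lambda>y. u y < c) (nhds x)"
    if "x \<in> S" "u x < c" for x c
    using that at_within_open[OF \<open>x \<in> S\<close> assms] by (simp add: eventually_nhds_conv_at)
  then show ?thesis
    unfolding usc_on_pointwise by auto
qed

lemma usc_on_cong: "(\<And>x. x \<in> S \<Longrightarrow> u x = v x) \<Longrightarrow> usc_on S u \<Longrightarrow> usc_on S v"
  unfolding usc_on_def by (metis (mono_tags, lifting) Collect_cong)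

lemma bounded_linear_scale_vec: "bounded_linear (\<lambda>\<zeta>. \<zeta> *s (b::complex^'n))"
  unfolding linear_conv_bounded_linear[symmetric]
  by (intro linearI) (auto simp: vec_eq_iff algebra_simps)

lemma line_has_derivative:
  "((\<lambda>\<zeta>. a + \<zeta> *s (b::complex^'n)) has_derivative (\<lambda>h. h *s b)) F"
  using has_derivative_add[OF has_derivative_const
      bounded_linear.has_derivative[OF bounded_linear_scale_vec has_derivative_ident]] by simp

lemma continuous_on_line: "continuous_on S (\<lambda>\<zeta>. a + \<zeta> *s (b::complex^'n))"
  by (intro continuous_intros bounded_linear.continuous_on[OF bounded_linear_scale_vec])

section \<open>Charts of the maximal atlas\<close>

lemma chartD:
  assumes "is_chart (U, \<phi>)"
  shows "open U" "open (\<phi> ` U)" "inj_on \<phi> U" "continuous_on U \<phi>"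
    "continuous_on (\<phi> ` U) (inv_into U \<phi>)"
    "\<And>z. z \<in> U \<Longrightarrow> inv_into U \<phi> (\<phi> z) = z"
    "\<And>x. x \<in> \<phi> ` U \<Longrightarrow> inv_into U \<phi> x \<in> U"
    "\<And>x. x \<in> \<phi> ` U \<Longrightarrow> \<phi> (inv_into U \<phi> x) = x"
proof -
  have h: "homeomorphism U (\<phi> ` U) \<phi> (inv_into U \<phi>)" "open U" "open (\<phi> ` U)"
    using assms by (auto simp: is_chart_def)
  then show "open U" "open (\<phi> ` U)" "continuous_on U \<phi>" "continuous_on (\<phi> ` U) (inv_into U \<phi>)"
    "\<And>z. z \<in> U \<Longrightarrow> inv_into U \<phi> (\<phi> z) = z"
    by (auto simp: homeomorphism_def)
  then show "inj_on \<phi> U" by (metis inj_on_inverseI)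
  show "\<And>x. x \<in> \<phi> ` U \<Longrightarrow> inv_into U \<phi> x \<in> U"
    by (rule inv_into_into)
  show "\<And>x. x \<in> \<phi> ` U \<Longrightarrow> \<phi> (inv_into U \<phi> x) = x"
    by (rule f_inv_into_f)
qed

lemma maximal_atlas_chart: "c \<in> maximal_atlas A \<Longrightarrow> is_chart c"
  by (simp add: maximal_atlas_def)

lemma chart_open_image:
  assumes "is_chart (U, \<phi>)" "open N"
  shows "open (\<phi> ` (U \<inter> N))"
proof -
  have "\<phi> ` (U \<inter> N) = inv_into U \<phi> -` N \<inter> \<phi> ` U"
    using chartD[OF assms(1)] by (force simp: image_iff)
  moreover have "open (inv_into U \<phi> -` N \<inter> \<phi> ` U)"
    using chartD[OF assms(1)] assms(2) continuous_on_open_vimage by blast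
  ultimately show ?thesis by simp
qed

lemma chart_image_eq:
  assumes "is_chart (U, \<phi>)"
  shows "\<phi> ` (U \<inter> N) = {x \<in> \<phi> ` U. inv_into U \<phi> x \<in> N}"
  using chartD[OF assms] by (force simp: image_iff)

lemma atlas_subset_maximal: "complex_atlas A \<Longrightarrow> A \<subseteq> maximal_atlas A"
  unfolding complex_atlas_def maximal_atlas_def by blast

lemma exists_chart_at:
  assumes "complex_atlas A"
  obtains U \<phi> where "(U, \<phi>) \<in> maximal_atlas A" "z \<in> U"
proof -
  have "z \<in> (\<Union>c\<in>A. fst c)" using assms by (simp add: complex_atlas_def)
  then show ?thesis
    using that atlas_subset_maximal[OF assms] by (metis UN_E prod.collapse subsetD)
qed

text \<open>Membership in \<open>maximal_atlas A\<close> only gives compatibility with charts of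
  \<open>A\<close>. Near each point the transition is therefore factored through a chart
  \<open>\<theta>\<close> of \<open>A\<close> around that point.\<close>

lemma holomorphic_transition:
  assumes A: "complex_atlas A" and c: "(U, \<phi>) \<in> maximal_atlas A" and d: "(V, \<psi>) \<in> maximal_atlas A"
  shows "holomorphic_map_on (\<psi> \<circ> inv_into U \<phi>) (\<phi> ` (U \<inter> V))"
  unfolding holomorphic_map_on_def
proof
  fix x assume "x \<in> \<phi> ` (U \<inter> V)"
  then obtain z where z: "z \<in> U" "z \<in> V" "x = \<phi> z" by auto
  have "z \<in> (\<Union>c\<in>A. fst c)" using A by (simp add: complex_atlas_def)
  then obtain W \<theta> where W: "(W, \<theta>) \<in> A" "z \<in> W" by auto
  note cU = chartD[OF maximal_atlas_chart[OF c]]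
  have "is_chart (W, \<theta>)" using A W by (auto simp: complex_atlas_def)
  note cW = chartD[OF this]
  have "holomorphic_map_on (\<theta> \<circ> inv_into U \<phi>) (\<phi> ` (U \<inter> W))"
    using c W by (auto simp: maximal_atlas_def compatible_def)
  then obtain D1 where D1: "((\<theta> \<circ> inv_into U \<phi>) has_derivative D1) (at x)" "\<forall>c v. D1 (c *s v) = c *s D1 v"
    unfolding holomorphic_map_on_def using z W by blast
  have "holomorphic_map_on (\<psi> \<circ> inv_into W \<theta>) (\<theta> ` (V \<inter> W))"
    using d W by (auto simp: maximal_atlas_def compatible_def Int_commute)
  then obtain D2 where D2: "((\<psi> \<circ> inv_into W \<theta>) has_derivative D2) (at (\<theta> z))" "\<forall>c v. D2 (c *s v) = c *s D2 v"
    unfolding holomorphic_map_on_def using z W by blast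
  have "((\<psi> \<circ> inv_into W \<theta>) \<circ> (\<theta> \<circ> inv_into U \<phi>) has_derivative D2 \<circ> D1) (at x)"
    using D1(1) D2(1) z cU(6) by (intro diff_chain_at) auto
  then have "((\<psi> \<circ> inv_into U \<phi>) has_derivative D2 \<circ> D1) (at x)"
  proof (rule has_derivative_transform_within_open)
    show "open (\<phi> ` (U \<inter> W))"
      by (rule chart_open_image[OF maximal_atlas_chart[OF c] cW(1)])
    show "x \<in> \<phi> ` (U \<inter> W)" using z W by auto
    show "((\<psi> \<circ> inv_into W \<theta>) \<circ> (\<theta> \<circ> inv_into U \<phi>)) y = (\<psi> \<circ> inv_into U \<phi>) y" if "y \<in> \<phi> ` (U \<inter> W)" for y
      using that cU(6) cW(6) by auto
  qed
  then show "\<exists>D. ((\<psi> \<circ> inv_into U \<phi>) has_derivative D) (at x) \<and> (\<forall>c v. D (c *s v) = c *s D v)"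
    using D1(2) D2(2) by (intro exI[of _ "D2 \<circ> D1"]) auto
qed

text \<open>Poles and strictness are defined by conditions on the whole of a chart domain; this
  allows the domain to be shrunk to where the condition has been proved. The inverses over
  \<open>N\<close> and \<open>U\<close> agree on the image of \<open>N\<close> by
  injectivity.\<close>

lemma maximal_atlas_restrict:
  assumes A: "complex_atlas A" and c: "(U, \<phi>) \<in> maximal_atlas A" and N: "open N" "N \<subseteq> U"
  shows "(N, \<phi>) \<in> maximal_atlas A"
proof -
  have ch: "is_chart (U, \<phi>)" by (rule maximal_atlas_chart[OF c])
  note cU = chartD[OF ch]
  have inj: "inj_on \<phi> N" using cU(3) N(2) by (rule inj_on_subset)
  have inv: "inv_into N \<phi> x = inv_into U \<phi> x" if "x \<in> \<phi> ` N" for x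
  proof -
    from that obtain z where "z \<in> N" "x = \<phi> z" by auto
    then show ?thesis using inj cU(3) N(2) by (auto simp: inv_into_f_f)
  qed
  have oN: "open (\<phi> ` (N \<inter> S))" if "open S" for S
  proof -
    have "N \<inter> S = U \<inter> (N \<inter> S)" using N by auto
    then show ?thesis using chart_open_image[OF ch open_Int[OF N(1) that]] by simp
  qed
  have "is_chart (N, \<phi>)"
    unfolding is_chart_def homeomorphism_def prod.case
  proof (intro conjI N(1))
    show "open (\<phi> ` N)" using oN[of UNIV] by simp
    show "continuous_on N \<phi>" using cU(4) N(2) by (rule continuous_on_subset)
    show "continuous_on (\<phi> ` N) (inv_into N \<phi>)"
      using continuous_on_subset[OF cU(5) image_mono[OF N(2)]] inv
      by (simp cong: continuous_on_cong)
    show "inv_into N \<phi> ` \<phi> ` N = N" using inj by (force simp: image_iff inv_into_f_f)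
  qed (use inj in \<open>auto simp: inv_into_f_f\<close>)
  moreover have "compatible (N, \<phi>) (V, \<psi>)" if d: "(V, \<psi>) \<in> A" for V \<psi>
  proof -
    have oV: "open V"
      using chartD(1) A d by (fastforce simp: complex_atlas_def)
    have *: "holomorphic_map_on (\<psi> \<circ> inv_into U \<phi>) (\<phi> ` (U \<inter> V))"
        "holomorphic_map_on (\<phi> \<circ> inv_into V \<psi>) (\<psi> ` (U \<inter> V))"
      using c d by (auto simp: maximal_atlas_def compatible_def)
    have "\<exists>D. ((\<psi> \<circ> inv_into N \<phi>) has_derivative D) (at x) \<and> (\<forall>c v. D (c *s v) = c *s D v)"
      if x: "x \<in> \<phi> ` (N \<inter> V)" for x
    proof -
      have "x \<in> \<phi> ` (U \<inter> V)" using x N by auto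
      then obtain D where D: "((\<psi> \<circ> inv_into U \<phi>) has_derivative D) (at x)" "\<forall>c v. D (c *s v) = c *s D v"
        using *(1) unfolding holomorphic_map_on_def by blast
      have "((\<psi> \<circ> inv_into N \<phi>) has_derivative D) (at x)"
        by (rule has_derivative_transform_within_open[OF D(1) oN[OF oV] x]) (auto simp: inv)
      then show ?thesis using D(2) by blast
    qed
    then show ?thesis
      using *(2) N(2) unfolding compatible_def holomorphic_map_on_def by auto
  qed
  ultimately show ?thesis
    by (auto simp: maximal_atlas_def)
qed

section \<open>Discs and plurisubharmonic germs\<close>

text \<open>Complex lines through \<open>z\<close>, read in arbitrary charts. The maps are total,
  but meaningful only for small arguments, as long as the line stays in the image of the chart; all
  later statements shrink the radius accordingly.\<close>

definition discs :: "('m::topological_space, 'n::finite) chart set \<Rightarrow> 'm \<Rightarrow> (complex \<Rightarrow> 'm) set" where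
  "discs A z = {\<gamma>. \<exists>V \<psi> b. (V, \<psi>) \<in> maximal_atlas A \<and> z \<in> V \<and>
     \<gamma> = (\<lambda>\<zeta>. inv_into V \<psi> (\<psi> z + \<zeta> *s b))}"

lemma disc_center: "\<gamma> \<in> discs A z \<Longrightarrow> \<gamma> 0 = z"
  unfolding discs_def using chartD(6)[OF maximal_atlas_chart] by auto

lemma disc_continuous:
  assumes "\<gamma> \<in> discs A z" "open N" "z \<in> N"
  shows "\<exists>\<rho>>0. continuous_on (ball 0 \<rho>) \<gamma> \<and> \<gamma> ` ball 0 \<rho> \<subseteq> N"
proof -
  obtain V \<psi> b where V: "(V, \<psi>) \<in> maximal_atlas A" "z \<in> V"
    "\<gamma> = (\<lambda>\<zeta>. inv_into V \<psi> (\<psi> z + \<zeta> *s b))"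
    using assms(1) unfolding discs_def by blast
  note ch = maximal_atlas_chart[OF V(1)]
  note cV = chartD[OF ch]
  define D where "D = (\<lambda>\<zeta>. \<psi> z + \<zeta> *s b) -` (\<psi> ` (V \<inter> N))"
  have "open D"
    unfolding D_def by (intro open_vimage chart_open_image[OF ch assms(2)] continuous_on_line)
  moreover have "0 \<in> D" using V assms by (auto simp: D_def)
  ultimately obtain \<rho> where \<rho>: "\<rho> > 0" "ball 0 \<rho> \<subseteq> D"
    by (auto simp: open_contains_ball)
  have "continuous_on (ball 0 \<rho>) \<gamma>"
    unfolding V(3) by (rule continuous_on_compose2[OF cV(5) continuous_on_line])
      (use \<rho> in \<open>auto simp: D_def\<close>)
  moreover have "\<gamma> \<zeta> \<in> N" if "\<zeta> \<in> ball 0 \<rho>" for \<zeta>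
    using that \<rho>(2) unfolding V(3) D_def chart_image_eq[OF ch] by auto
  ultimately show ?thesis using \<rho>(1) by blast
qed

text \<open>A line of one chart becomes a holomorphic curve in any other: by the chain rule its
  derivative is \<open>D (h *s b) = h *s D b\<close>, and complex linearity of \<open>D\<close>
  makes this a complex derivative in each coordinate.\<close>

lemma disc_holomorphic:
  assumes A: "complex_atlas A" and "\<gamma> \<in> discs A z" and c: "(U, \<phi>) \<in> maximal_atlas A" "z \<in> U"
  shows "\<exists>\<rho>>0. \<gamma> ` ball 0 \<rho> \<subseteq> U \<and> (\<forall>i. (\<lambda>\<zeta>. \<phi> (\<gamma> \<zeta>) $ i) holomorphic_on ball 0 \<rho>)"
proof -
  obtain V \<psi> b where V: "(V, \<psi>) \<in> maximal_atlas A" "z \<in> V"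
    "\<gamma> = (\<lambda>\<zeta>. inv_into V \<psi> (\<psi> z + \<zeta> *s b))"
    using assms(2) unfolding discs_def by blast
  note ch = maximal_atlas_chart[OF V(1)]
  define D where "D = (\<lambda>\<zeta>. \<psi> z + \<zeta> *s b) -` (\<psi> ` (V \<inter> U))"
  have "open D"
    unfolding D_def
    by (intro open_vimage chart_open_image[OF ch chartD(1)[OF maximal_atlas_chart[OF c(1)]]] continuous_on_line)
  moreover have "0 \<in> D" using V c by (auto simp: D_def)
  ultimately obtain \<rho> where \<rho>: "\<rho> > 0" "ball 0 \<rho> \<subseteq> D"
    by (auto simp: open_contains_ball)
  have "(\<lambda>\<zeta>. \<phi> (\<gamma> \<zeta>) $ i) field_differentiable at \<zeta>" if "\<zeta> \<in> ball 0 \<rho>" for \<zeta> i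
  proof -
    have "\<psi> z + \<zeta> *s b \<in> \<psi> ` (V \<inter> U)" using that \<rho> by (auto simp: D_def)
    then obtain D where D: "((\<phi> \<circ> inv_into V \<psi>) has_derivative D) (at (\<psi> z + \<zeta> *s b))"
        "\<And>c v. D (c *s v) = c *s D v"
      using holomorphic_transition[OF A V(1) c(1)] unfolding holomorphic_map_on_def by blast
    have "((\<lambda>\<zeta>. \<phi> (\<gamma> \<zeta>)) has_derivative (\<lambda>h. D (h *s b))) (at \<zeta>)"
      using diff_chain_at[OF line_has_derivative D(1)] unfolding V(3) o_def .
    from bounded_linear.has_derivative[OF bounded_linear_vec_nth[of i] this]
    have "((\<lambda>\<zeta>. \<phi> (\<gamma> \<zeta>) $ i) has_derivative (\<lambda>h. h * (D b $ i))) (at \<zeta>)"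
      by (simp add: D(2))
    then have "((\<lambda>\<zeta>. \<phi> (\<gamma> \<zeta>) $ i) has_field_derivative (D b $ i)) (at \<zeta>)"
      by (simp add: has_field_derivative_def mult_commute_abs)
    then show ?thesis by (auto simp: field_differentiable_def)
  qed
  then have "(\<lambda>\<zeta>. \<phi> (\<gamma> \<zeta>) $ i) holomorphic_on ball 0 \<rho>" for i
    by (simp add: holomorphic_on_def field_differentiable_at_within)
  moreover have "\<gamma> \<zeta> \<in> U" if "\<zeta> \<in> ball 0 \<rho>" for \<zeta>
    using that \<rho>(2) unfolding V(3) D_def chart_image_eq[OF ch] by auto
  ultimately show ?thesis using \<rho>(1) by blast
qed

definition psh_at :: "('m::topological_space, 'n::finite) chart set \<Rightarrow> ('m \<Rightarrow> ereal) \<Rightarrow> 'm \<Rightarrow> bool" where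
  "psh_at A u z \<longleftrightarrow> u z < \<infinity> \<and> (\<forall>c>u z. eventually (\<lambda>y. u y < c) (nhds z)) \<and>
     (\<forall>\<gamma>\<in>discs A z. \<exists>\<rho>>0. \<forall>r. 0 < r \<and> r < \<rho> \<longrightarrow> u z \<le> circle_mean (u \<circ> \<gamma>) 0 r)"

lemma circle_mean_line:
  "circle_mean (\<lambda>\<zeta>. u (a + \<zeta> *s b)) \<zeta>0 r = circle_mean (\<lambda>\<zeta>. u ((a + \<zeta>0 *s b) + \<zeta> *s b)) 0 r"
  by (simp add: circle_mean_def vector_sadd_rdistrib add.assoc)

text \<open>
  A point of \<open>W\<close> and a complex line through it in some chart give a disc; this turns
  plurisubharmonicity into a property of germs.
\<close>

lemma psh_on_iff:
  assumes A: "complex_atlas A" and W: "open W"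
  shows "psh_on A W u \<longleftrightarrow> (\<forall>z\<in>W. psh_at A u z)"
proof
  assume L: "psh_on A W u"
  show "\<forall>z\<in>W. psh_at A u z"
  proof
    fix z assume z: "z \<in> W"
    obtain U \<phi> where U: "(U, \<phi>) \<in> maximal_atlas A" "z \<in> U" using exists_chart_at[OF A] .
    note cU = chartD[OF maximal_atlas_chart[OF U(1)]]
    have "usc_on (\<phi> ` (U \<inter> W)) (u \<circ> inv_into U \<phi>)"
      using L U(1) unfolding psh_on_def psh_domain_def by blast
    then have "usc_on (U \<inter> W) ((u \<circ> inv_into U \<phi>) \<circ> \<phi>)"
      by (rule usc_on_compose) (auto intro: continuous_on_subset[OF cU(4)])
    then have "usc_on (U \<inter> W) u"
      by (rule usc_on_cong[rotated]) (simp add: cU(6))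
    then have usc: "u z < \<infinity>" "\<forall>c>u z. eventually (\<lambda>y. u y < c) (nhds z)"
      using usc_on_open_iff[OF open_Int[OF cU(1) W]] U z by auto
    have "\<exists>\<rho>>0. \<forall>r. 0 < r \<and> r < \<rho> \<longrightarrow> u z \<le> circle_mean (u \<circ> \<gamma>) 0 r" if \<gamma>: "\<gamma> \<in> discs A z" for \<gamma>
    proof -
      obtain V \<psi> b where V: "(V, \<psi>) \<in> maximal_atlas A" "z \<in> V"
        "\<gamma> = (\<lambda>\<zeta>. inv_into V \<psi> (\<psi> z + \<zeta> *s b))"
        using \<gamma> unfolding discs_def by blast
      note cV = chartD[OF maximal_atlas_chart[OF V(1)]]
      have "subharmonic_on {\<zeta>. \<psi> z + \<zeta> *s b \<in> \<psi> ` (V \<inter> W)} (\<lambda>\<zeta>. (u \<circ> inv_into V \<psi>) (\<psi> z + \<zeta> *s b))"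
        using L V(1) unfolding psh_on_def psh_domain_def by blast
      moreover have "0 \<in> {\<zeta>. \<psi> z + \<zeta> *s b \<in> \<psi> ` (V \<inter> W)}"
        using V z by auto
      ultimately obtain \<rho> where "\<rho> > 0"
        "\<forall>r. 0 < r \<and> r < \<rho> \<longrightarrow> (u \<circ> inv_into V \<psi>) (\<psi> z + 0 *s b) \<le>
            circle_mean (\<lambda>\<zeta>. (u \<circ> inv_into V \<psi>) (\<psi> z + \<zeta> *s b)) 0 r"
        unfolding subharmonic_on_def by blast
      then show ?thesis
        using cV(6)[OF V(2)] unfolding V(3) by (auto simp: o_def)
    qed
    with usc show "psh_at A u z" by (simp add: psh_at_def)
  qed
next
  assume R: "\<forall>z\<in>W. psh_at A u z"
  have usc: "usc_on W u"
    using R by (simp add: usc_on_open_iff[OF W] psh_at_def)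
  have "psh_domain (\<psi> ` (V \<inter> W)) (u \<circ> inv_into V \<psi>)" if V: "(V, \<psi>) \<in> maximal_atlas A" for V \<psi>
  proof -
    note ch = maximal_atlas_chart[OF V]
    note cV = chartD[OF ch]
    have 1: "usc_on (\<psi> ` (V \<inter> W)) (u \<circ> inv_into V \<psi>)"
      by (rule usc_on_compose[OF usc])
         (auto intro: continuous_on_subset[OF cV(5)] simp: cV(6))
    have "subharmonic_on {\<zeta>. a + \<zeta> *s b \<in> \<psi> ` (V \<inter> W)} (\<lambda>\<zeta>. (u \<circ> inv_into V \<psi>) (a + \<zeta> *s b))" for a b
    proof -
      define D where "D = {\<zeta>. a + \<zeta> *s b \<in> \<psi> ` (V \<inter> W)}"
      have "open D"
        unfolding D_def vimage_def[symmetric]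
        by (intro open_vimage chart_open_image[OF ch W] continuous_on_line)
      have "usc_on D ((u \<circ> inv_into V \<psi>) \<circ> (\<lambda>\<zeta>. a + \<zeta> *s b))"
        by (rule usc_on_compose[OF 1 continuous_on_line]) (auto simp: D_def)
      moreover have "\<exists>\<rho>>0. ball \<zeta>0 \<rho> \<subseteq> D \<and> (\<forall>r. 0 < r \<and> r < \<rho> \<longrightarrow>
          (u \<circ> inv_into V \<psi>) (a + \<zeta>0 *s b) \<le> circle_mean (\<lambda>\<zeta>. (u \<circ> inv_into V \<psi>) (a + \<zeta> *s b)) \<zeta>0 r)"
        if \<zeta>0: "\<zeta>0 \<in> D" for \<zeta>0
      proof -
        obtain \<rho>1 where \<rho>1: "\<rho>1 > 0" "ball \<zeta>0 \<rho>1 \<subseteq> D"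
          using \<open>open D\<close> \<zeta>0 by (auto simp: open_contains_ball)
        obtain z where z: "z \<in> V" "z \<in> W" "\<psi> z = a + \<zeta>0 *s b"
          using \<zeta>0 by (auto simp: D_def)
        define \<gamma> where "\<gamma> = (\<lambda>\<zeta>. inv_into V \<psi> (\<psi> z + \<zeta> *s b))"
        have "\<gamma> \<in> discs A z"
          using V z unfolding discs_def \<gamma>_def by blast
        then obtain \<rho>2 where \<rho>2: "\<rho>2 > 0" "\<forall>r. 0 < r \<and> r < \<rho>2 \<longrightarrow> u z \<le> circle_mean (u \<circ> \<gamma>) 0 r"
          using R z unfolding psh_at_def by blast
        have "u \<circ> \<gamma> = (\<lambda>\<zeta>. (u \<circ> inv_into V \<psi>) ((a + \<zeta>0 *s b) + \<zeta> *s b))"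
          by (simp add: \<gamma>_def z(3) o_def)
        then have "circle_mean (u \<circ> \<gamma>) 0 r = circle_mean (\<lambda>\<zeta>. (u \<circ> inv_into V \<psi>) (a + \<zeta> *s b)) \<zeta>0 r" for r
          using circle_mean_line[of "u \<circ> inv_into V \<psi>" a b \<zeta>0 r] by simp
        moreover have "u z = (u \<circ> inv_into V \<psi>) (a + \<zeta>0 *s b)"
          using z cV(6) by (simp flip: z(3))
        ultimately show ?thesis
          using \<rho>1 \<rho>2 by (intro exI[of _ "min \<rho>1 \<rho>2"]) auto
      qed
      ultimately show ?thesis
        unfolding subharmonic_on_def D_def[symmetric] by (simp add: o_def)
    qed
    with 1 show ?thesis
      unfolding psh_domain_def by blast
  qed
  then show "psh_on A W u"
    unfolding psh_on_def by blast
qed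

text \<open>The basis of all gluing: a function defined by cases only has to agree, near each point,
  with some function already known to be plurisubharmonic there.\<close>

lemma psh_at_cong:
  assumes "eventually (\<lambda>y. u y = v y) (nhds z)" "psh_at A u z"
  shows "psh_at A v z"
proof -
  obtain N where N: "open N" "z \<in> N" "\<And>y. y \<in> N \<Longrightarrow> u y = v y"
    using assms(1) by (auto simp: eventually_nhds)
  have "eventually (\<lambda>y. v y < c) (nhds z)" if "c > v z" for c
  proof -
    have "eventually (\<lambda>y. u y < c) (nhds z)"
      using assms(2) that N(3)[OF N(2)] by (auto simp: psh_at_def)
    with assms(1) show ?thesis by eventually_elim simp
  qed
  moreover have "\<exists>\<rho>>0. \<forall>r. 0 < r \<and> r < \<rho> \<longrightarrow> v z \<le> circle_mean (v \<circ> \<gamma>) 0 r" if \<gamma>: "\<gamma> \<in> discs A z" for \<gamma>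
  proof -
    obtain \<rho>1 where \<rho>1: "\<rho>1 > 0" "\<gamma> ` ball 0 \<rho>1 \<subseteq> N"
      using disc_continuous[OF \<gamma> N(1,2)] by blast
    obtain \<rho>2 where \<rho>2: "\<rho>2 > 0" "\<forall>r. 0 < r \<and> r < \<rho>2 \<longrightarrow> u z \<le> circle_mean (u \<circ> \<gamma>) 0 r"
      using assms(2) \<gamma> unfolding psh_at_def by blast
    have "circle_mean (u \<circ> \<gamma>) 0 r = circle_mean (v \<circ> \<gamma>) 0 r" if "0 < r" "r < \<rho>1" for r
      using \<rho>1 that N(3) by (intro circle_mean_cong) (auto simp: image_subset_iff)
    then show ?thesis
      using \<rho>1 \<rho>2 N(3)[OF N(2)] by (intro exI[of _ "min \<rho>1 \<rho>2"]) auto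
  qed
  ultimately show ?thesis
    using assms(2) N(3)[OF N(2)] by (auto simp: psh_at_def)
qed

lemma psh_at_max:
  assumes "psh_at A u z" "psh_at A v z"
  shows "psh_at A (\<lambda>y. max (u y) (v y)) z"
proof -
  have "eventually (\<lambda>y. max (u y) (v y) < c) (nhds z)" if "c > max (u z) (v z)" for c
  proof -
    have "eventually (\<lambda>y. u y < c) (nhds z)" "eventually (\<lambda>y. v y < c) (nhds z)"
      using assms that by (auto simp: psh_at_def)
    then show ?thesis by eventually_elim simp
  qed
  moreover have "\<exists>\<rho>>0. \<forall>r. 0 < r \<and> r < \<rho> \<longrightarrow>
      max (u z) (v z) \<le> circle_mean ((\<lambda>y. max (u y) (v y)) \<circ> \<gamma>) 0 r" if \<gamma>: "\<gamma> \<in> discs A z" for \<gamma>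
  proof -
    obtain \<rho>1 where \<rho>1: "\<rho>1 > 0" "\<forall>r. 0 < r \<and> r < \<rho>1 \<longrightarrow> u z \<le> circle_mean (u \<circ> \<gamma>) 0 r"
      using assms(1) \<gamma> unfolding psh_at_def by blast
    obtain \<rho>2 where \<rho>2: "\<rho>2 > 0" "\<forall>r. 0 < r \<and> r < \<rho>2 \<longrightarrow> v z \<le> circle_mean (v \<circ> \<gamma>) 0 r"
      using assms(2) \<gamma> unfolding psh_at_def by blast
    have "circle_mean (u \<circ> \<gamma>) 0 r \<le> circle_mean ((\<lambda>y. max (u y) (v y)) \<circ> \<gamma>) 0 r"
      "circle_mean (v \<circ> \<gamma>) 0 r \<le> circle_mean ((\<lambda>y. max (u y) (v y)) \<circ> \<gamma>) 0 r" if "0 < r" for r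
      using that by (auto intro!: circle_mean_mono)
    then show ?thesis
      using \<rho>1 \<rho>2 by (intro exI[of _ "min \<rho>1 \<rho>2"]) (auto intro: order_trans)
  qed
  moreover have "max (u z) (v z) < \<infinity>"
    using assms by (simp add: psh_at_def max_def)
  ultimately show ?thesis
    unfolding psh_at_def by blast
qed

text \<open>The submean inequality is void at the value \<open>-\<infinity>\<close>, so only upper
  semicontinuity is left to check.\<close>

lemma psh_at_MInfty:
  assumes "u z = -\<infinity>" "\<And>c. eventually (\<lambda>y. u y < ereal c) (nhds z)"
  shows "psh_at A u z"
proof -
  have "eventually (\<lambda>y. u y < c) (nhds z)" if "c > u z" for c
    using assms(2)
  proof (cases c)
    case PInf
    show ?thesis using assms(2)[of 0] unfolding PInf by eventually_elim auto
  qed (use that assms in auto)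
  then show ?thesis using assms(1) unfolding psh_at_def by (auto intro: exI[of _ 1])
qed

lemma disc_continuous_comp:
  assumes "\<gamma> \<in> discs A z" "open N" "z \<in> N" "continuous_on N q"
  shows "\<exists>\<rho>>0. \<gamma> ` ball 0 \<rho> \<subseteq> N \<and> continuous_on (ball 0 \<rho>) (\<lambda>\<zeta>. q (\<gamma> \<zeta>))"
  using disc_continuous[OF assms(1-3)] continuous_on_compose2[OF assms(4)] by blast

text \<open>Continuity supplies upper semicontinuity, and on circles small enough for the disc to
  stay in \<open>N\<close> the extended mean is an ordinary integral. The right-hand side is
  additive in \<open>q\<close>, which \<open>circle_mean\<close> is not in general.\<close>

lemma psh_at_ereal_iff:
  assumes N: "open N" "z \<in> N" "continuous_on N q"
  shows "psh_at A (\<lambda>y. ereal (q y)) z \<longleftrightarrow>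
    (\<forall>\<gamma>\<in>discs A z. \<exists>\<rho>>0. \<forall>r. 0 < r \<and> r < \<rho> \<longrightarrow> 2 * pi * q z \<le> circle_integral (\<lambda>\<zeta>. q (\<gamma> \<zeta>)) 0 r)"
proof -
  have "usc_on N (\<lambda>y. 0 + ereal (q y))"
    by (rule usc_on_add_continuous[OF _ N(3)]) (simp add: usc_on_pointwise)
  then have "\<forall>c>ereal (q z). eventually (\<lambda>y. ereal (q y) < c) (nhds z)"
    using N by (simp add: usc_on_open_iff)
  then have "psh_at A (\<lambda>y. ereal (q y)) z \<longleftrightarrow>
    (\<forall>\<gamma>\<in>discs A z. \<exists>\<rho>>0. \<forall>r. 0 < r \<and> r < \<rho> \<longrightarrow> ereal (q z) \<le> circle_mean (\<lambda>\<zeta>. ereal (q (\<gamma> \<zeta>))) 0 r)"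
    by (auto simp: psh_at_def o_def)
  also have "\<dots> \<longleftrightarrow> (\<forall>\<gamma>\<in>discs A z. \<exists>\<rho>>0. \<forall>r. 0 < r \<and> r < \<rho> \<longrightarrow>
      2 * pi * q z \<le> circle_integral (\<lambda>\<zeta>. q (\<gamma> \<zeta>)) 0 r)"
  proof (rule ball_cong[OF refl])
    fix \<gamma> assume "\<gamma> \<in> discs A z"
    then obtain \<rho>1 where \<rho>1: "\<rho>1 > 0" "continuous_on (ball 0 \<rho>1) (\<lambda>\<zeta>. q (\<gamma> \<zeta>))"
      using disc_continuous_comp[OF _ N] by blast
    have *: "ereal (q z) \<le> circle_mean (\<lambda>\<zeta>. ereal (q (\<gamma> \<zeta>))) 0 r \<longleftrightarrow>
        2 * pi * q z \<le> circle_integral (\<lambda>\<zeta>. q (\<gamma> \<zeta>)) 0 r" if "0 < r" "r < \<rho>1" for r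
    proof -
      have "continuous_on (sphere 0 r) (\<lambda>\<zeta>. q (\<gamma> \<zeta>))"
        by (rule continuous_on_subset[OF \<rho>1(2)]) (use that in auto)
      then show ?thesis using that by (simp add: circle_mean_ereal field_simps)
    qed
    show "(\<exists>\<rho>>0. \<forall>r. 0 < r \<and> r < \<rho> \<longrightarrow> ereal (q z) \<le> circle_mean (\<lambda>\<zeta>. ereal (q (\<gamma> \<zeta>))) 0 r)
      \<longleftrightarrow> (\<exists>\<rho>>0. \<forall>r. 0 < r \<and> r < \<rho> \<longrightarrow> 2 * pi * q z \<le> circle_integral (\<lambda>\<zeta>. q (\<gamma> \<zeta>)) 0 r)"
      (is "?L \<longleftrightarrow> ?R")
    proof
      assume ?L then obtain \<rho> where "\<rho> > 0"
        "\<forall>r. 0 < r \<and> r < \<rho> \<longrightarrow> ereal (q z) \<le> circle_mean (\<lambda>\<zeta>. ereal (q (\<gamma> \<zeta>))) 0 r" by blast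
      then show ?R using * \<rho>1(1) by (intro exI[of _ "min \<rho> \<rho>1"]) auto
    next
      assume ?R then obtain \<rho> where "\<rho> > 0"
        "\<forall>r. 0 < r \<and> r < \<rho> \<longrightarrow> 2 * pi * q z \<le> circle_integral (\<lambda>\<zeta>. q (\<gamma> \<zeta>)) 0 r" by blast
      then show ?L using * \<rho>1(1) by (intro exI[of _ "min \<rho> \<rho>1"]) auto
    qed
  qed
  finally show ?thesis .
qed

section \<open>Harmonic minorants\<close>

text \<open>A support function from below along each disc; \<open>g\<close> may vary with the disc.
  This can be verified by an explicit formula in one chart, although the discs come from all
  charts.\<close>

definition holomorphic_minorant ::
    "('m::topological_space, 'n::finite) chart set \<Rightarrow> ('m \<Rightarrow> real) \<Rightarrow> 'm \<Rightarrow> bool" where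
  "holomorphic_minorant A l z \<longleftrightarrow> (\<forall>\<gamma>\<in>discs A z. \<exists>\<rho>>0. \<exists>g. g holomorphic_on ball 0 \<rho> \<and>
     Re (g 0) = l z \<and> (\<forall>\<zeta>\<in>ball 0 \<rho>. Re (g \<zeta>) \<le> l (\<gamma> \<zeta>)))"

text \<open>By the mean value property of \<open>g\<close> the circle integral of \<open>l\<close>
  is at least \<open>2 * pi * l z\<close>; this is added to the submean inequality of
  \<open>q\<close>.\<close>

lemma psh_at_add_minorant:
  assumes N: "open N" "z \<in> N" and q: "continuous_on N q" "psh_at A (\<lambda>y. ereal (q y)) z"
    and l: "continuous_on N l" "holomorphic_minorant A l z"
  shows "psh_at A (\<lambda>y. ereal (q y + l y)) z"
proof (subst psh_at_ereal_iff[OF N])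
  show "continuous_on N (\<lambda>y. q y + l y)" by (intro continuous_intros q l)
  show "\<forall>\<gamma>\<in>discs A z. \<exists>\<rho>>0. \<forall>r. 0 < r \<and> r < \<rho> \<longrightarrow>
      2 * pi * (q z + l z) \<le> circle_integral (\<lambda>\<zeta>. q (\<gamma> \<zeta>) + l (\<gamma> \<zeta>)) 0 r"
  proof
    fix \<gamma> assume \<gamma>: "\<gamma> \<in> discs A z"
    obtain \<rho>1 where \<rho>1: "\<rho>1 > 0" "continuous_on (ball 0 \<rho>1) (\<lambda>\<zeta>. q (\<gamma> \<zeta>))"
      using disc_continuous_comp[OF \<gamma> N q(1)] by blast
    obtain \<rho>2 where \<rho>2: "\<rho>2 > 0" "continuous_on (ball 0 \<rho>2) (\<lambda>\<zeta>. l (\<gamma> \<zeta>))"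
      using disc_continuous_comp[OF \<gamma> N l(1)] by blast
    obtain \<rho>3 g where \<rho>3: "\<rho>3 > 0" "g holomorphic_on ball 0 \<rho>3" "Re (g 0) = l z"
        "\<forall>\<zeta>\<in>ball 0 \<rho>3. Re (g \<zeta>) \<le> l (\<gamma> \<zeta>)"
      using l(2) \<gamma> unfolding holomorphic_minorant_def by blast
    obtain \<rho>4 where \<rho>4: "\<rho>4 > 0" "\<forall>r. 0 < r \<and> r < \<rho>4 \<longrightarrow> 2 * pi * q z \<le> circle_integral (\<lambda>\<zeta>. q (\<gamma> \<zeta>)) 0 r"
      using q(2) \<gamma> unfolding psh_at_ereal_iff[OF N q(1)] by blast
    have "2 * pi * (q z + l z) \<le> circle_integral (\<lambda>\<zeta>. q (\<gamma> \<zeta>) + l (\<gamma> \<zeta>)) 0 r"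
      if r: "0 < r" "r < \<rho>1" "r < \<rho>2" "r < \<rho>3" "r < \<rho>4" for r
    proof -
      have cq: "continuous_on (sphere 0 r) (\<lambda>\<zeta>. q (\<gamma> \<zeta>))"
        by (rule continuous_on_subset[OF \<rho>1(2)]) (use r in auto)
      have cl: "continuous_on (sphere 0 r) (\<lambda>\<zeta>. l (\<gamma> \<zeta>))"
        by (rule continuous_on_subset[OF \<rho>2(2)]) (use r in auto)
      have cg: "continuous_on (sphere 0 r) (\<lambda>\<zeta>. Re (g \<zeta>))"
        by (intro continuous_intros continuous_on_subset[OF holomorphic_on_imp_continuous_on[OF \<rho>3(2)]])
           (use r in auto)
      have "2 * pi * l z = circle_integral (\<lambda>\<zeta>. Re (g \<zeta>)) 0 r"
        using circle_integral_Re_holomorphic[OF \<rho>3(2) r(1) r(4)] \<rho>3(3) by simp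
      also have "\<dots> \<le> circle_integral (\<lambda>\<zeta>. l (\<gamma> \<zeta>)) 0 r"
        using \<rho>3(4) r by (intro circle_integral_mono cg cl) auto
      finally show ?thesis
        using \<rho>4(2) r by (subst circle_integral_add[OF cq cl]) (auto simp: algebra_simps intro: add_mono)
    qed
    then show "\<exists>\<rho>>0. \<forall>r. 0 < r \<and> r < \<rho> \<longrightarrow>
      2 * pi * (q z + l z) \<le> circle_integral (\<lambda>\<zeta>. q (\<gamma> \<zeta>) + l (\<gamma> \<zeta>)) 0 r"
      using \<rho>1(1) \<rho>2(1) \<rho>3(1) \<rho>4(1) by (intro exI[of _ "Min {\<rho>1, \<rho>2, \<rho>3, \<rho>4}"]) auto
  qed
qed

lemma psh_at_const: "psh_at A (\<lambda>y. ereal c) z"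
proof (subst psh_at_ereal_iff[of UNIV])
  show "\<forall>\<gamma>\<in>discs A z. \<exists>\<rho>>0. \<forall>r. 0 < r \<and> r < \<rho> \<longrightarrow> 2 * pi * c \<le> circle_integral (\<lambda>\<zeta>. c) 0 r"
    by (auto simp: circle_integral_const intro: exI[of _ 1])
qed auto

lemma psh_at_minorant:
  assumes "open N" "z \<in> N" "continuous_on N l" "holomorphic_minorant A l z"
  shows "psh_at A (\<lambda>y. ereal (l y)) z"
  using psh_at_add_minorant[OF assms(1,2) _ psh_at_const[of A 0 z] assms(3,4)] by simp

lemma psh_at_cmult:
  assumes N: "open N" "z \<in> N" and q: "continuous_on N q" "psh_at A (\<lambda>y. ereal (q y)) z" and K: "K \<ge> 0"
  shows "psh_at A (\<lambda>y. ereal (K * q y)) z"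
proof (subst psh_at_ereal_iff[OF N])
  show "continuous_on N (\<lambda>y. K * q y)" by (intro continuous_intros q)
  have "2 * pi * (K * q z) \<le> circle_integral (\<lambda>\<zeta>. K * q (\<gamma> \<zeta>)) 0 r"
    if "2 * pi * q z \<le> circle_integral (\<lambda>\<zeta>. q (\<gamma> \<zeta>)) 0 r" for \<gamma> r
    unfolding circle_integral_cmult using mult_left_mono[OF that K] by (simp add: mult_ac)
  then show "\<forall>\<gamma>\<in>discs A z. \<exists>\<rho>>0. \<forall>r. 0 < r \<and> r < \<rho> \<longrightarrow>
      2 * pi * (K * q z) \<le> circle_integral (\<lambda>\<zeta>. K * q (\<gamma> \<zeta>)) 0 r"
    using q(2) unfolding psh_at_ereal_iff[OF N q(1)] by meson
qed

lemma holomorphic_minorant_mono: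
  assumes "holomorphic_minorant A k z" "k z = l z" "open N" "z \<in> N" "\<And>y. y \<in> N \<Longrightarrow> k y \<le> l y"
  shows "holomorphic_minorant A l z"
  unfolding holomorphic_minorant_def
proof
  fix \<gamma> assume \<gamma>: "\<gamma> \<in> discs A z"
  obtain \<rho>1 where \<rho>1: "\<rho>1 > 0" "\<gamma> ` ball 0 \<rho>1 \<subseteq> N"
    using disc_continuous[OF \<gamma> assms(3,4)] by blast
  obtain \<rho>2 g where \<rho>2: "\<rho>2 > 0" "g holomorphic_on ball 0 \<rho>2" "Re (g 0) = k z"
      "\<forall>\<zeta>\<in>ball 0 \<rho>2. Re (g \<zeta>) \<le> k (\<gamma> \<zeta>)"
    using assms(1) \<gamma> unfolding holomorphic_minorant_def by blast
  have "Re (g \<zeta>) \<le> l (\<gamma> \<zeta>)" if "\<zeta> \<in> ball 0 (min \<rho>1 \<rho>2)" for \<zeta>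
  proof -
    have "\<gamma> \<zeta> \<in> N" using that \<rho>1 by auto
    moreover have "Re (g \<zeta>) \<le> k (\<gamma> \<zeta>)" using that \<rho>2 by auto
    ultimately show ?thesis using assms(5) by (meson order_trans)
  qed
  moreover have "g holomorphic_on ball 0 (min \<rho>1 \<rho>2)"
    by (rule holomorphic_on_subset[OF \<rho>2(2)]) auto
  ultimately show "\<exists>\<rho>>0. \<exists>g. g holomorphic_on ball 0 \<rho> \<and> Re (g 0) = l z \<and> (\<forall>\<zeta>\<in>ball 0 \<rho>. Re (g \<zeta>) \<le> l (\<gamma> \<zeta>))"
    using \<rho>1(1) \<rho>2(1,3) assms(2) by (intro exI[of _ "min \<rho>1 \<rho>2"] conjI exI[of _ g]) auto
qed

section \<open>From strict poles to a strictly plurisubharmonic function\<close>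

text \<open>The real inner product with \<open>p\<close> is the real part of the Hermitian product,
  which is complex linear in \<open>\<phi> y\<close> and hence holomorphic along discs. The minorant
  even equals the function.\<close>

lemma minorant_inner:
  assumes A: "complex_atlas A" and c: "(U, \<phi>) \<in> maximal_atlas A" "z \<in> U"
  shows "holomorphic_minorant A (\<lambda>y. c + \<phi> y \<bullet> p) z"
  unfolding holomorphic_minorant_def
proof
  fix \<gamma> assume \<gamma>: "\<gamma> \<in> discs A z"
  obtain \<rho> where \<rho>: "\<rho> > 0" "\<And>i. (\<lambda>\<zeta>. \<phi> (\<gamma> \<zeta>) $ i) holomorphic_on ball 0 \<rho>"
    using disc_holomorphic[OF A \<gamma> c] by blast
  define g where "g = (\<lambda>\<zeta>. complex_of_real c + (\<Sum>i\<in>UNIV. cnj (p $ i) * \<phi> (\<gamma> \<zeta>) $ i))"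
  have "g holomorphic_on ball 0 \<rho>"
    unfolding g_def by (intro holomorphic_intros \<rho>)
  moreover have "Re (g \<zeta>) = c + \<phi> (\<gamma> \<zeta>) \<bullet> p" for \<zeta>
    by (simp add: g_def inner_vec_def inner_complex_def mult.commute)
  ultimately show "\<exists>\<rho>>0. \<exists>g. g holomorphic_on ball 0 \<rho> \<and> Re (g 0) = c + \<phi> z \<bullet> p \<and>
      (\<forall>\<zeta>\<in>ball 0 \<rho>. Re (g \<zeta>) \<le> c + \<phi> (\<gamma> \<zeta>) \<bullet> p)"
    using \<rho>(1) disc_center[OF \<gamma>] by (intro exI[of _ \<rho>] conjI exI[of _ g]) auto
qed

lemma minorant_const: "holomorphic_minorant A (\<lambda>y. c) z"
  unfolding holomorphic_minorant_def
  by (intro ballI exI[of _ 1] conjI exI[of _ "\<lambda>_. complex_of_real c"]) auto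

text \<open>The minorant of a convex function of the coordinates is its tangent plane.\<close>

lemma minorant_norm_power2:
  assumes A: "complex_atlas A" and c: "(U, \<phi>) \<in> maximal_atlas A" "z \<in> U" and \<alpha>: "\<alpha> \<ge> 0"
  shows "holomorphic_minorant A (\<lambda>y. c + \<alpha> * (norm (\<phi> y - p))\<^sup>2) z"
proof (rule holomorphic_minorant_mono[where N = UNIV])
  define q where "q = \<phi> z - p"
  show "holomorphic_minorant A (\<lambda>y. (c + \<alpha> * (norm q)\<^sup>2 - 2 * \<alpha> * (\<phi> z \<bullet> q)) + \<phi> y \<bullet> ((2 * \<alpha>) *\<^sub>R q)) z"
    by (rule minorant_inner[OF A c])
  \<comment> \<open>Expansion about \<open>\<phi> z\<close>: the quadratic function exceeds its
    tangent plane exactly by \<open>\<alpha> * (norm (\<phi> y - \<phi> z))^2\<close>.\<close>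
  have "c + \<alpha> * (norm (\<phi> y - p))\<^sup>2 =
    ((c + \<alpha> * (norm q)\<^sup>2 - 2 * \<alpha> * (\<phi> z \<bullet> q)) + \<phi> y \<bullet> ((2 * \<alpha>) *\<^sub>R q)) + \<alpha> * (norm (\<phi> y - \<phi> z))\<^sup>2" for y
    by (simp add: q_def power2_norm_eq_inner inner_simps inner_commute algebra_simps)
  then show "(c + \<alpha> * (norm q)\<^sup>2 - 2 * \<alpha> * (\<phi> z \<bullet> q)) + \<phi> z \<bullet> ((2 * \<alpha>) *\<^sub>R q) = c + \<alpha> * (norm (\<phi> z - p))\<^sup>2"
    "(c + \<alpha> * (norm q)\<^sup>2 - 2 * \<alpha> * (\<phi> z \<bullet> q)) + \<phi> y \<bullet> ((2 * \<alpha>) *\<^sub>R q) \<le> c + \<alpha> * (norm (\<phi> y - p))\<^sup>2" for y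
    using \<alpha> by simp_all
qed auto

lemma cmod_sum_cnj_mult_le:
  "cmod (\<Sum>i\<in>UNIV. cnj (e $ i) * (x::complex^'n) $ i) \<le> norm e * norm x"
proof -
  have "cmod (\<Sum>i\<in>UNIV. cnj (e $ i) * x $ i) \<le> (\<Sum>i\<in>UNIV. \<bar>norm (e $ i)\<bar> * \<bar>norm (x $ i)\<bar>)"
    by (rule order_trans[OF norm_sum]) (simp add: norm_mult)
  also have "\<dots> \<le> norm e * norm x"
    unfolding norm_vec_def by (rule L2_set_mult_ineq)
  finally show ?thesis .
qed

text \<open>
  With \<open>e = \<phi> z - p\<close>, Cauchy--Schwarz bounds the norm of \<open>\<phi> y - p\<close> below by the modulus of a
  function of \<open>y\<close> that is holomorphic along discs and does not vanish at \<open>z\<close>.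
\<close>

lemma minorant_ln_norm:
  assumes A: "complex_atlas A" and c: "(U, \<phi>) \<in> maximal_atlas A" "z \<in> U" and ne: "\<phi> z \<noteq> p"
  shows "holomorphic_minorant A (\<lambda>y. ln (norm (\<phi> y - p)) + c) z"
  unfolding holomorphic_minorant_def
proof
  fix \<gamma> assume \<gamma>: "\<gamma> \<in> discs A z"
  obtain \<rho> where \<rho>: "\<rho> > 0" "\<And>i. (\<lambda>\<zeta>. \<phi> (\<gamma> \<zeta>) $ i) holomorphic_on ball 0 \<rho>"
    using disc_holomorphic[OF A \<gamma> c] by blast
  define e where "e = \<phi> z - p"
  have e: "norm e > 0" using ne by (simp add: e_def)
  \<comment> \<open>Division by \<open>norm e\<close> makes the Cauchy--Schwarz bound an equality at
    the centre, so the minorant touches there.\<close>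
  define G where "G = (\<lambda>\<zeta>. (\<Sum>i\<in>UNIV. cnj (e $ i) * (\<phi> (\<gamma> \<zeta>) $ i - p $ i)) / of_real (norm e))"
  have Ghol: "G holomorphic_on ball 0 \<rho>"
    unfolding G_def using e by (intro holomorphic_intros \<rho>) auto
  have G0: "G 0 = of_real (norm e)"
  proof -
    have "(\<Sum>i\<in>UNIV. cnj (e $ i) * (\<phi> (\<gamma> 0) $ i - p $ i)) = (\<Sum>i\<in>UNIV. of_real ((norm (e $ i))\<^sup>2))"
      unfolding disc_center[OF \<gamma>]
      by (intro sum.cong refl) (simp only: e_def vector_minus_component complex_norm_square mult.commute)
    also have "\<dots> = of_real ((norm e)\<^sup>2)"
      by (simp add: norm_vec_def L2_set_def sum_nonneg)
    finally show ?thesis using e by (simp add: G_def power2_eq_square)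
  qed
  have Gle: "cmod (G \<zeta>) \<le> norm (\<phi> (\<gamma> \<zeta>) - p)" for \<zeta>
    using cmod_sum_cnj_mult_le[of e "\<phi> (\<gamma> \<zeta>) - p"] e by (simp add: G_def norm_divide field_simps)
  have "isCont G 0"
    using holomorphic_on_imp_continuous_on[OF Ghol] \<rho>(1) by (simp add: continuous_on_eq_continuous_at)
  then have "(G \<longlongrightarrow> G 0) (nhds 0)"
    by (simp add: isCont_def tendsto_at_iff_tendsto_nhds)
  \<comment> \<open>Near 0 the values of \<open>G\<close> stay in the right half-plane, so the
    principal logarithm is holomorphic there and has real part
    \<open>ln (cmod (G \<zeta>))\<close>.\<close>
  from order_tendstoD(1)[OF tendsto_Re[OF this], of 0]
  have "eventually (\<lambda>\<zeta>. Re (G \<zeta>) > 0) (nhds 0)"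
    using e G0 by simp
  then obtain \<rho>' where \<rho>': "\<rho>' > 0" "\<And>\<zeta>. \<zeta> \<in> ball 0 \<rho>' \<Longrightarrow> Re (G \<zeta>) > 0"
    by (auto simp: eventually_nhds_metric dist_commute)
  define g where "g = (\<lambda>\<zeta>. Ln (G \<zeta>) + of_real c)"
  have "g holomorphic_on ball 0 (min \<rho> \<rho>')"
    unfolding g_def
  proof (intro holomorphic_intros)
    show "G holomorphic_on ball 0 (min \<rho> \<rho>')"
      by (rule holomorphic_on_subset[OF Ghol]) auto
    show "G \<zeta> \<notin> \<real>\<^sub>\<le>\<^sub>0" if "\<zeta> \<in> ball 0 (min \<rho> \<rho>')" for \<zeta>
      using \<rho>'(2)[of \<zeta>] that by (auto simp: complex_nonpos_Reals_iff)
  qed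
  moreover have "Re (g 0) = ln (norm (\<phi> z - p)) + c"
  proof -
    have "G 0 \<noteq> 0" using G0 e by simp
    then show ?thesis using G0 by (simp add: g_def e_def)
  qed
  moreover have "Re (g \<zeta>) \<le> ln (norm (\<phi> (\<gamma> \<zeta>) - p)) + c" if "\<zeta> \<in> ball 0 (min \<rho> \<rho>')" for \<zeta>
  proof -
    have "G \<zeta> \<noteq> 0" using \<rho>'(2)[of \<zeta>] that by auto
    then show ?thesis using ln_mono[OF Gle[of \<zeta>]] by (simp add: g_def)
  qed
  ultimately show "\<exists>\<rho>>0. \<exists>g. g holomorphic_on ball 0 \<rho> \<and> Re (g 0) = ln (norm (\<phi> z - p)) + c \<and>
      (\<forall>\<zeta>\<in>ball 0 \<rho>. Re (g \<zeta>) \<le> ln (norm (\<phi> (\<gamma> \<zeta>) - p)) + c)"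
    using \<rho>(1) \<rho>'(1) by (intro exI[of _ "min \<rho> \<rho>'"] conjI exI[of _ g]) auto
qed

section \<open>Coordinate balls, and removal of a strict pole\<close>

lemma open_Collect_less_on:
  fixes f :: "'a::topological_space \<Rightarrow> real"
  assumes "open U" "continuous_on U f"
  shows "open {y \<in> U. f y < r}" "open {y \<in> U. r < f y}"
proof -
  have "open (f -` {..<r} \<inter> U)" "open (f -` {r<..} \<inter> U)"
    using assms(2) by (simp_all add: continuous_on_open_vimage[OF assms(1)])
  moreover have "f -` {..<r} \<inter> U = {y \<in> U. f y < r}" "f -` {r<..} \<inter> U = {y \<in> U. r < f y}"
    by auto
  ultimately show "open {y \<in> U. f y < r}" "open {y \<in> U. r < f y}"
    by simp_all
qed

text \<open>Closed in the manifold and not merely in \<open>U\<close>: the set is a continuous image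
  of a compact ball, hence compact, and the manifold is Hausdorff. Its complement then serves as an
  open piece in gluings.\<close>

lemma closed_coordinate_cball:
  fixes \<phi> :: "'m::t2_space \<Rightarrow> complex^'n"
  assumes "is_chart (U, \<phi>)" "cball p R \<subseteq> \<phi> ` U" "r \<le> R"
  shows "closed {y \<in> U. norm (\<phi> y - p) \<le> r}"
proof -
  note cU = chartD[OF assms(1)]
  have sub: "cball p r \<subseteq> \<phi> ` U" using assms(2,3) by force
  have "{y \<in> U. norm (\<phi> y - p) \<le> r} = inv_into U \<phi> ` cball p r"
  proof (intro equalityI subsetI)
    fix y assume "y \<in> {y \<in> U. norm (\<phi> y - p) \<le> r}"
    then have "y = inv_into U \<phi> (\<phi> y)" "\<phi> y \<in> cball p r"
      using cU(6) by (auto simp: dist_norm norm_minus_commute)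
    then show "y \<in> inv_into U \<phi> ` cball p r" by (rule image_eqI)
  next
    fix y assume "y \<in> inv_into U \<phi> ` cball p r"
    then obtain x where x: "x \<in> cball p r" "y = inv_into U \<phi> x" by blast
    moreover have "x \<in> \<phi> ` U" using x(1) sub by blast
    ultimately show "y \<in> {y \<in> U. norm (\<phi> y - p) \<le> r}"
      using cU(7,8) by (simp add: dist_norm norm_minus_commute)
  qed
  moreover have "compact (inv_into U \<phi> ` cball p r)"
    by (intro compact_continuous_image continuous_on_subset[OF cU(5) sub] compact_cball)
  ultimately show ?thesis by (simp add: compact_imp_closed)
qed

lemma chart_contains_cball:
  assumes "is_chart (U, \<phi>)" "w \<in> U"
  obtains r where "r > 0" "cball (\<phi> w) r \<subseteq> \<phi> ` U"
  using chartD(2)[OF assms(1)] assms(2) by (meson imageI open_contains_cball)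

lemma elog_le_ereal_iff: "elog x \<le> ereal c \<longleftrightarrow> x \<le> exp c"
proof (cases "x \<le> 0")
  case True
  then show ?thesis using le_less_trans[OF True exp_gt_zero[of c]] by (simp add: elog_def)
next
  case False
  then show ?thesis by (simp add: elog_def) (metis exp_le_cancel_iff exp_ln not_le)
qed

lemma elog_less_ereal_iff: "elog x < ereal c \<longleftrightarrow> x < exp c"
proof (cases "x \<le> 0")
  case True
  then show ?thesis using le_less_trans[OF True exp_gt_zero[of c]] by (simp add: elog_def)
next
  case False
  then show ?thesis by (simp add: elog_def) (metis exp_less_cancel_iff exp_ln not_le)
qed

text \<open>The two bounds of the strict pole have opposite tasks: the lower one makes
  \<open>v\<close> the larger function on an annulus, where the two maxima then coincide; the upper
  one makes \<open>v\<close> the smaller function close to \<open>w\<close>. The bound 1 on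
  \<open>f\<close> is a normalisation for the later series.\<close>

lemma strict_pole_local_strictly_psh:
  fixes A :: "('m::{t2_space,second_countable_topology}, 'n::finite) chart set"
  assumes A: "complex_atlas A"
    and v: "\<And>z. v z < 0" "continuous_on UNIV v" "psh_on A UNIV v" "strict_log_pole A v w"
  shows "\<exists>N f U \<phi> \<alpha> c p. w \<in> N \<and> open N \<and> N \<subseteq> U \<and> (U, \<phi>) \<in> maximal_atlas A \<and> \<alpha> > 0 \<and>
    continuous_on UNIV f \<and> (\<forall>y. \<bar>f y\<bar> \<le> 1) \<and> psh_on A UNIV (\<lambda>y. ereal (f y)) \<and>
    (\<forall>y\<in>N. f y = c + \<alpha> * (norm (\<phi> y - p))\<^sup>2)"
proof -
  obtain U \<phi> c1 c2 where U: "(U, \<phi>) \<in> maximal_atlas A" "w \<in> U" and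
    pole: "\<And>z. z \<in> U \<Longrightarrow> elog (norm (\<phi> z - \<phi> w)) + ereal c1 \<le> v z"
    "\<And>z. z \<in> U \<Longrightarrow> v z \<le> elog (norm (\<phi> z - \<phi> w)) + ereal c2"
    using v(4) unfolding strict_log_pole_def by blast
  note ch = maximal_atlas_chart[OF U(1)]
  note cU = chartD[OF ch]
  obtain r where r: "r > 0" "cball (\<phi> w) r \<subseteq> \<phi> ` U" using chart_contains_cball[OF ch U(2)] .
  define R where "R = (\<lambda>y. norm (\<phi> y - \<phi> w))"
  have Req: "norm (\<phi> y - \<phi> w) = R y" for y by (simp add: R_def)
  have Rc: "continuous_on U R" unfolding R_def by (intro continuous_intros cU)
  \<comment> \<open>Gives \<open>r^2 - C = ln (r/2) + c1 - 1\<close>, which lies below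
    \<open>v\<close> wherever \<open>r/2 < R y < r\<close>.\<close>
  define C where "C = r\<^sup>2 - ln (r/2) - c1 + 1"
  define N1 where "N1 = {y \<in> U. R y < r}"
  define N2 where "N2 = - {y \<in> U. R y \<le> r/2}"
  have open1: "open N1" unfolding N1_def by (intro open_Collect_less_on cU Rc)
  have open2: "open N2"
    unfolding N2_def R_def using closed_coordinate_cball[OF ch r(2), of "r/2"] r(1) by (simp add: open_Compl)
  have cover: "y \<in> N1 \<or> y \<in> N2" for y using r by (auto simp: N1_def N2_def)
  define h where "h = (\<lambda>y. if y \<in> N1 then max (v y) (ereal ((R y)\<^sup>2 - C)) else max (v y) (ereal (- C)))"
  have h1: "h y = max (v y) (ereal ((R y)\<^sup>2 - C))" if "y \<in> N1" for y using that by (simp add: h_def)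
  have h2: "h y = max (v y) (ereal (- C))" if "y \<in> N2" for y
  proof (cases "y \<in> N1")
    case True
    then have y: "y \<in> U" "r/2 < R y" "R y < r" using that by (auto simp: N1_def N2_def)
    have "(R y)\<^sup>2 \<le> r\<^sup>2" using y r by (intro power_mono) auto
    moreover have "ln (r/2) \<le> ln (R y)" using y r by simp
    ultimately have "(R y)\<^sup>2 - C \<le> ln (R y) + c1" by (simp add: C_def)
    moreover have "elog (R y) = ereal (ln (R y))" using y r by (simp add: elog_def)
    ultimately have "ereal ((R y)\<^sup>2 - C) \<le> elog (R y) + ereal c1" by simp
    then have "ereal ((R y)\<^sup>2 - C) \<le> v y"
      using pole(1)[OF y(1)] unfolding Req by (rule order_trans)
    moreover have "ereal (- C) \<le> ereal ((R y)\<^sup>2 - C)" by simp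
    ultimately have "max (v y) (ereal ((R y)\<^sup>2 - C)) = v y" "max (v y) (ereal (- C)) = v y"
      by (meson max_absorb1 order_trans)+
    then show ?thesis by (simp add: h_def)
  qed (simp add: h_def)
  have hlow: "ereal (- C) \<le> h y" for y
    by (auto simp: h_def le_max_iff_disj)
  have hup: "h y \<le> ereal (\<bar>C\<bar> + r\<^sup>2)" for y
  proof -
    have "v y \<le> ereal (\<bar>C\<bar> + r\<^sup>2)"
      using less_imp_le[OF v(1)[of y]] by (rule order_trans) simp
    moreover have "(R y)\<^sup>2 \<le> r\<^sup>2" if "y \<in> N1"
      using that by (intro power_mono) (auto simp: N1_def R_def)
    moreover have "- C \<le> \<bar>C\<bar> + r\<^sup>2" using zero_le_power2[of r] by linarith
    ultimately show ?thesis by (auto simp: h_def)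
  qed
  have hfin: "\<bar>h y\<bar> \<noteq> \<infinity>" for y
    using hlow[of y] hup[of y] by (cases "h y") auto
  have "continuous_on N1 (\<lambda>y. max (v y) (ereal ((R y)\<^sup>2 - C)))"
    by (intro continuous_on_max continuous_on_subset[OF v(2)] continuous_intros continuous_on_ereal
        continuous_on_subset[OF Rc]) (auto simp: N1_def)
  then have "continuous_on N1 h" by (rule continuous_on_eq) (simp add: h1)
  moreover have "continuous_on N2 (\<lambda>y. max (v y) (ereal (- C)))"
    by (intro continuous_on_max continuous_on_subset[OF v(2)] continuous_intros) auto
  then have "continuous_on N2 h" by (rule continuous_on_eq) (simp add: h2)
  moreover have "N1 \<union> N2 = UNIV" using cover by auto
  ultimately have hc: "continuous_on UNIV h"
    using continuous_on_open_Un[OF open1 open2, of h] by simp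
  have hpsh: "psh_at A h y" for y
  proof -
    have vp: "psh_at A v y"
      using v(3) psh_on_iff[OF A open_UNIV] by blast
    from cover[of y] show ?thesis
    proof
      assume y: "y \<in> N1"
      then have yU: "y \<in> U" by (simp add: N1_def)
      have "psh_at A (\<lambda>y. ereal (- C + 1 * (norm (\<phi> y - \<phi> w))\<^sup>2)) y"
        by (rule psh_at_minorant[OF cU(1) yU _ minorant_norm_power2[OF A U(1) yU]])
           (auto intro!: continuous_intros cU)
      then have "psh_at A (\<lambda>y. max (v y) (ereal ((R y)\<^sup>2 - C))) y"
        by (intro psh_at_max vp) (simp add: R_def)
      moreover have "eventually (\<lambda>y. max (v y) (ereal ((R y)\<^sup>2 - C)) = h y) (nhds y)"
        using open1 y h1 by (auto simp: eventually_nhds)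
      ultimately show ?thesis by (rule psh_at_cong[rotated])
    next
      assume y: "y \<in> N2"
      have "psh_at A (\<lambda>y. max (v y) (ereal (- C))) y"
        by (intro psh_at_max vp psh_at_const)
      moreover have "eventually (\<lambda>y. max (v y) (ereal (- C)) = h y) (nhds y)"
        using open2 y h2 unfolding eventually_nhds by (intro exI[of _ N2]) auto
      ultimately show ?thesis by (rule psh_at_cong[rotated])
    qed
  qed
  define B where "B = \<bar>C\<bar> + r\<^sup>2 + 1"
  have B: "B > 0" using zero_le_power2[of r] unfolding B_def by linarith
  define q where "q = (\<lambda>y. real_of_ereal (h y))"
  have qh: "ereal (q y) = h y" for y using hfin[of y] by (simp add: q_def ereal_real)
  have qc: "continuous_on UNIV q"
    using hc continuous_on_iff_real[of UNIV h] hfin by (simp add: q_def o_def)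
  define f where "f = (\<lambda>y. (1/B) * q y)"
  have fc: "continuous_on UNIV f" unfolding f_def by (intro continuous_intros qc)
  have qb: "\<bar>q y\<bar> \<le> B" for y
  proof -
    have "ereal (- C) \<le> ereal (q y)" "ereal (q y) \<le> ereal (\<bar>C\<bar> + r\<^sup>2)"
      unfolding qh by (rule hlow, rule hup)
    then have "- C \<le> q y" "q y \<le> \<bar>C\<bar> + r\<^sup>2" by simp_all
    then show ?thesis using zero_le_power2[of r] unfolding B_def by linarith
  qed
  have "\<forall>y. \<bar>f y\<bar> \<le> 1"
    using qb B by (simp add: f_def abs_mult)
  moreover have "psh_on A UNIV (\<lambda>y. ereal (f y))"
    unfolding psh_on_iff[OF A open_UNIV] f_def
    using hpsh B by (intro ballI psh_at_cmult[OF open_UNIV UNIV_I qc]) (simp_all add: qh)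
  \<comment> \<open>Here \<open>ln (R y) + c2 < - C\<close> off the centre, so \<open>v\<close> lies
    below \<open>- C\<close> and the quadratic function wins; the bound \<open>r\<close> keeps
    \<open>N\<close> inside \<open>N1\<close>.\<close>
  moreover define N where "N = {y \<in> U. R y < min r (exp (- C - c2))}"
  have "open N" unfolding N_def by (intro open_Collect_less_on cU Rc)
  moreover have "w \<in> N" using U r by (simp add: N_def R_def)
  moreover have "\<forall>y\<in>N. f y = - C / B + 1/B * (norm (\<phi> y - \<phi> w))\<^sup>2"
  proof
    fix y assume y: "y \<in> N"
    then have yU: "y \<in> U" and yN: "y \<in> N1" and "R y < exp (- C - c2)"
      by (auto simp: N_def N1_def)
    then have "elog (R y) \<le> ereal (- C - c2)" by (simp add: elog_le_ereal_iff)
    then have "elog (R y) + ereal c2 \<le> ereal (- C)" by (cases "elog (R y)") auto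
    then have "v y \<le> ereal (- C)" using pole(2)[OF yU] unfolding Req by (rule order_trans[rotated])
    moreover have "ereal (- C) \<le> ereal ((R y)\<^sup>2 - C)" by simp
    ultimately have "h y = ereal ((R y)\<^sup>2 - C)"
      using h1[OF yN] by (metis max_absorb2 order_trans)
    then have "q y = (R y)\<^sup>2 - C" by (simp add: q_def)
    then show "f y = - C / B + 1/B * (norm (\<phi> y - \<phi> w))\<^sup>2"
      by (simp add: f_def R_def diff_divide_distrib)
  qed
  moreover have "N \<subseteq> U" by (auto simp: N_def)
  moreover have "1/B > 0" using B by simp
  ultimately show ?thesis using U(1) fc
    by (intro exI[of _ N] exI[of _ f] exI[of _ U] exI[of _ \<phi>] exI[of _ "1/B"] exI[of _ "-C/B"] exI[of _ "\<phi> w"])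
       blast
qed

section \<open>Countable sums\<close>

text \<open>The radius precedes \<open>q\<close> in the quantifiers. It only has to keep the disc
  continuous and its line inside the chart image; the submean inequality on every such circle then
  follows from \<open>subharmonic_on_submean_circle\<close>.\<close>

lemma disc_submean_uniform:
  assumes \<gamma>: "\<gamma> \<in> discs A z"
  shows "\<exists>\<rho>>0. \<forall>q r. continuous_on UNIV q \<longrightarrow> psh_on A UNIV (\<lambda>y. ereal (q y)) \<longrightarrow> 0 < r \<longrightarrow> r < \<rho> \<longrightarrow>
    2 * pi * q z \<le> circle_integral (\<lambda>\<zeta>. q (\<gamma> \<zeta>)) 0 r"
proof -
  obtain V \<psi> b where V: "(V, \<psi>) \<in> maximal_atlas A" "z \<in> V"
    "\<gamma> = (\<lambda>\<zeta>. inv_into V \<psi> (\<psi> z + \<zeta> *s b))"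
    using \<gamma> unfolding discs_def by blast
  note cV = chartD[OF maximal_atlas_chart[OF V(1)]]
  define D where "D = {\<zeta>. \<psi> z + \<zeta> *s b \<in> \<psi> ` (V \<inter> UNIV)}"
  have "open D"
    unfolding D_def vimage_def[symmetric] using cV(2) by (intro open_vimage continuous_on_line) auto
  moreover have "0 \<in> D" using V by (simp add: D_def)
  ultimately obtain \<rho>1 where \<rho>1: "\<rho>1 > 0" "ball 0 \<rho>1 \<subseteq> D" by (auto simp: open_contains_ball)
  obtain \<rho>2 where \<rho>2: "\<rho>2 > 0" "continuous_on (ball 0 \<rho>2) \<gamma>"
    using disc_continuous[OF \<gamma> open_UNIV UNIV_I] by blast
  have "2 * pi * q z \<le> circle_integral (\<lambda>\<zeta>. q (\<gamma> \<zeta>)) 0 r"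
    if q: "continuous_on UNIV q" "psh_on A UNIV (\<lambda>y. ereal (q y))" and r: "0 < r" "r < \<rho>1" "r < \<rho>2" for q r
  proof -
    have "subharmonic_on D (\<lambda>\<zeta>. ((\<lambda>y. ereal (q y)) \<circ> inv_into V \<psi>) (\<psi> z + \<zeta> *s b))"
      using q(2) V(1) unfolding psh_on_def psh_domain_def D_def by blast
    then have "subharmonic_on D (\<lambda>\<zeta>. ereal (q (\<gamma> \<zeta>)))" by (simp add: V(3))
    then have "2 * pi * q (\<gamma> 0) \<le> circle_integral (\<lambda>\<zeta>. q (\<gamma> \<zeta>)) 0 r"
    proof (rule subharmonic_on_submean_circle)
      show "cball 0 r \<subseteq> D" using \<rho>1 r by (auto simp: subset_iff)
      show "continuous_on (sphere 0 r) (\<lambda>\<zeta>. q (\<gamma> \<zeta>))"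
        by (rule continuous_on_compose2[OF q(1) continuous_on_subset[OF \<rho>2(2)]]) (use r in auto)
    qed (rule r)
    then show ?thesis by (simp add: disc_center[OF \<gamma>])
  qed
  then show ?thesis using \<rho>1(1) \<rho>2(1) by (intro exI[of _ "min \<rho>1 \<rho>2"]) auto
qed

lemma circle_integral_sum:
  assumes "\<And>i. continuous_on (sphere a r) (F i)" "0 \<le> r"
  shows "circle_integral (\<lambda>z. \<Sum>i<(n::nat). k i * F i z) a r = (\<Sum>i<n. k i * circle_integral (F i) a r)"
proof (induction n)
  case 0
  show ?case by (simp add: circle_integral_const)
next
  case (Suc n)
  have "circle_integral (\<lambda>z. (\<Sum>i<n. k i * F i z) + k n * F n z) a r
      = circle_integral (\<lambda>z. \<Sum>i<n. k i * F i z) a r + circle_integral (\<lambda>z. k n * F n z) a r"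
    by (intro circle_integral_add continuous_intros assms)
  then show ?case by (simp add: Suc circle_integral_cmult)
qed

text \<open>The partial sums converge uniformly, and all terms satisfy the submean inequality on the
  same circles, so the inequality passes to the limit together with continuity.\<close>

lemma psh_series:
  fixes F :: "nat \<Rightarrow> 'm::{t2_space,second_countable_topology} \<Rightarrow> real"
  assumes A: "complex_atlas A"
    and F: "\<And>j. continuous_on UNIV (F j)" "\<And>j y. \<bar>F j y\<bar> \<le> 1" "\<And>j. psh_on A UNIV (\<lambda>y. ereal (F j y))"
  defines "S \<equiv> \<lambda>y. \<Sum>j. (1/2)^j * F j y"
  shows "continuous_on UNIV S" "psh_on A UNIV (\<lambda>y. ereal (S y))" "\<bar>S y\<bar> \<le> 2"
    "summable (\<lambda>j. (1/2)^j * F j y)"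
proof -
  have le: "norm ((1/2)^j * F j y) \<le> (1/2)^j" for j y
    using F(2)[of j y] by (simp add: abs_mult)
  have sm: "summable (\<lambda>j. (1/2::real)^j)" by simp
  show summ: "summable (\<lambda>j. (1/2)^j * F j y)" for y
    by (rule summable_comparison_test'[OF sm le])
  have "norm (S y) \<le> (\<Sum>j. (1/2)^j)"
    unfolding S_def by (rule norm_suminf_le[OF le sm])
  then show "\<bar>S y\<bar> \<le> 2" by (simp add: suminf_geometric)
  have ul: "uniform_limit UNIV (\<lambda>n y. \<Sum>j<n. (1/2)^j * F j y) S sequentially"
    unfolding S_def by (rule Weierstrass_m_test[OF le sm])
  show Sc: "continuous_on UNIV S"
    by (rule uniform_limit_theorem[OF _ ul]) (auto intro!: always_eventually continuous_intros F)
  have "2 * pi * S z \<le> circle_integral (\<lambda>\<zeta>. S (\<gamma> \<zeta>)) 0 r"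
    if sub: "\<And>j. 2 * pi * F j z \<le> circle_integral (\<lambda>\<zeta>. F j (\<gamma> \<zeta>)) 0 r" and r: "0 < r"
      and \<gamma>: "continuous_on (sphere 0 r) \<gamma>" for z \<gamma> r
  proof (rule field_le_epsilon)
    fix e' :: real assume "e' > 0"
    \<comment> \<open>The sum is replaced by a partial sum once at \<open>z\<close> and once on the
      circle, each at the cost of \<open>2 * pi * e\<close>.\<close>
    define e where "e = e' / (4 * pi)"
    have "e > 0" using \<open>e' > 0\<close> by (simp add: e_def)
    then obtain n where n: "\<And>y. dist (\<Sum>j<n. (1/2)^j * F j y) (S y) < e"
      using ul unfolding uniform_limit_iff eventually_sequentially by blast
    have Fc: "continuous_on (sphere 0 r) (\<lambda>\<zeta>. F j (\<gamma> \<zeta>))" for j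
      by (rule continuous_on_compose2[OF F(1) \<gamma>]) auto
    have Sc': "continuous_on (sphere 0 r) (\<lambda>\<zeta>. S (\<gamma> \<zeta>))"
      by (rule continuous_on_compose2[OF Sc \<gamma>]) auto
    have "S z \<le> (\<Sum>j<n. (1/2)^j * F j z) + e"
      using n[of z] by (simp add: dist_real_def)
    then have "2 * pi * S z \<le> 2 * pi * ((\<Sum>j<n. (1/2)^j * F j z) + e)" by simp
    also have "\<dots> = (\<Sum>j<n. (1/2)^j * (2 * pi * F j z)) + 2 * pi * e"
      by (simp add: distrib_left sum_distrib_left mult_ac)
    also have "(\<Sum>j<n. (1/2)^j * (2 * pi * F j z)) \<le> (\<Sum>j<n. (1/2)^j * circle_integral (\<lambda>\<zeta>. F j (\<gamma> \<zeta>)) 0 r)"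
      by (intro sum_mono mult_left_mono sub) auto
    also have "\<dots> = circle_integral (\<lambda>\<zeta>. \<Sum>j<n. (1/2)^j * F j (\<gamma> \<zeta>)) 0 r"
      using r by (intro circle_integral_sum[symmetric] Fc) auto
    also have "\<dots> \<le> circle_integral (\<lambda>\<zeta>. S (\<gamma> \<zeta>) + e) 0 r"
    proof (intro circle_integral_mono continuous_intros Fc Sc')
      show "(\<Sum>j<n. (1/2)^j * F j (\<gamma> \<zeta>)) \<le> S (\<gamma> \<zeta>) + e" for \<zeta>
        using n[of "\<gamma> \<zeta>"] by (simp add: dist_real_def)
    qed (use r in auto)
    also have "\<dots> = circle_integral (\<lambda>\<zeta>. S (\<gamma> \<zeta>)) 0 r + 2 * pi * e"
      using r by (subst circle_integral_add[OF Sc']) (auto simp: circle_integral_const)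
    finally show "2 * pi * S z \<le> circle_integral (\<lambda>\<zeta>. S (\<gamma> \<zeta>)) 0 r + e'"
      by (simp add: e_def)
  qed note key = this
  show "psh_on A UNIV (\<lambda>y. ereal (S y))"
    unfolding psh_on_iff[OF A open_UNIV]
  proof
    fix z
    show "psh_at A (\<lambda>y. ereal (S y)) z"
      unfolding psh_at_ereal_iff[OF open_UNIV UNIV_I Sc]
    proof
      fix \<gamma> assume \<gamma>: "\<gamma> \<in> discs A z"
      obtain \<rho>1 where \<rho>1: "\<rho>1 > 0" "\<And>q r. continuous_on UNIV q \<Longrightarrow> psh_on A UNIV (\<lambda>y. ereal (q y)) \<Longrightarrow>
          0 < r \<Longrightarrow> r < \<rho>1 \<Longrightarrow> 2 * pi * q z \<le> circle_integral (\<lambda>\<zeta>. q (\<gamma> \<zeta>)) 0 r"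
        using disc_submean_uniform[OF \<gamma>] by blast
      obtain \<rho>2 where \<rho>2: "\<rho>2 > 0" "continuous_on (ball 0 \<rho>2) \<gamma>"
        using disc_continuous[OF \<gamma> open_UNIV UNIV_I] by blast
      have "2 * pi * S z \<le> circle_integral (\<lambda>\<zeta>. S (\<gamma> \<zeta>)) 0 r" if r: "0 < r" "r < \<rho>1" "r < \<rho>2" for r
        by (intro key \<rho>1(2) F continuous_on_subset[OF \<rho>2(2)]) (use r in auto)
      then show "\<exists>\<rho>>0. \<forall>r. 0 < r \<and> r < \<rho> \<longrightarrow> 2 * pi * S z \<le> circle_integral (\<lambda>\<zeta>. S (\<gamma> \<zeta>)) 0 r"
        using \<rho>1(1) \<rho>2(1) by (intro exI[of _ "min \<rho>1 \<rho>2"]) auto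
    qed
  qed
qed

text \<open>Strictness at \<open>w\<close> is carried by a single term of the series, the one whose
  set \<open>N j\<close> contains \<open>w\<close>; the other terms only have to be
  plurisubharmonic.\<close>

lemma strictly_psh_from_strict_poles:
  fixes A :: "('m::{t2_space,second_countable_topology}, 'n::finite) chart set"
  assumes A: "complex_atlas A"
    and poles: "\<forall>w. \<exists>v. (\<forall>z. v z < 0) \<and> continuous_on UNIV v \<and> psh_on A UNIV v \<and> strict_log_pole A v w"
  shows "\<exists>u. bounded_fun u \<and> continuous_on UNIV u \<and> strictly_psh A u"
proof -
  define P where "P = (\<lambda>N f U \<phi> \<alpha> c p. open N \<and> N \<subseteq> U \<and> (U, \<phi>) \<in> maximal_atlas A \<and> \<alpha> > 0 \<and>
    continuous_on UNIV f \<and> (\<forall>y. \<bar>f y\<bar> \<le> 1) \<and> psh_on A UNIV (\<lambda>y. ereal (f y)) \<and>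
    (\<forall>y\<in>N. f y = c + \<alpha> * (norm (\<phi> y - p))\<^sup>2))"
  have loc: "\<exists>N f U \<phi> \<alpha> c p. w \<in> N \<and> P N f U \<phi> \<alpha> c p" for w
  proof -
    obtain v where "\<And>z. v z < 0" "continuous_on UNIV v" "psh_on A UNIV v" "strict_log_pole A v w"
      using poles by blast
    from strict_pole_local_strictly_psh[OF A this] show ?thesis
      unfolding P_def .
  qed
  define \<F> where "\<F> = {N. \<exists>f U \<phi> \<alpha> c p. P N f U \<phi> \<alpha> c p}"
  obtain \<F>' where \<F>': "\<F>' \<subseteq> \<F>" "countable \<F>'" "\<Union>\<F>' = \<Union>\<F>"
  proof (rule Lindelof)
    show "open N" if "N \<in> \<F>" for N using that by (auto simp: \<F>_def P_def)
  qed
  have cover: "\<Union>\<F>' = UNIV"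
    unfolding \<F>'(3) \<F>_def using loc by blast
  then have "\<F>' \<noteq> {}" by auto
  \<comment> \<open>If the subcover is finite, the enumeration repeats sets. This is harmless, as
    the data are chosen and summed by index.\<close>
  define N where "N = from_nat_into \<F>'"
  have rN: "range N = \<F>'" unfolding N_def by (rule range_from_nat_into[OF \<open>\<F>' \<noteq> {}\<close> \<F>'(2)])
  then have "\<exists>f U \<phi> \<alpha> c p. P (N j) f U \<phi> \<alpha> c p" for j
    using \<F>'(1) unfolding \<F>_def by blast
  then obtain f U \<phi> \<alpha> c p where P: "\<And>j. P (N j) (f j) (U j) (\<phi> j) (\<alpha> j) (c j) (p j)"
    by metis
  have f: "\<And>j. continuous_on UNIV (f j)" "\<And>j y. \<bar>f j y\<bar> \<le> 1" "\<And>j. psh_on A UNIV (\<lambda>y. ereal (f j y))"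
    using P by (auto simp: P_def)
  define S where "S = (\<lambda>y. \<Sum>j. (1/2)^j * f j y)"
  have Sprops: "continuous_on UNIV S" "psh_on A UNIV (\<lambda>y. ereal (S y))" "\<bar>S y\<bar> \<le> 2" for y
    unfolding S_def by (rule psh_series[where F = f, OF A f])+
  have "strictly_psh A (\<lambda>y. ereal (S y))"
    unfolding strictly_psh_def
  proof (intro conjI allI Sprops)
    fix w
    obtain j where j: "w \<in> N j" using cover rN by blast
    have Nj: "open (N j)" "N j \<subseteq> U j" "(U j, \<phi> j) \<in> maximal_atlas A" "\<alpha> j > 0"
      "\<And>y. y \<in> N j \<Longrightarrow> f j y = c j + \<alpha> j * (norm (\<phi> j y - p j))\<^sup>2"
      using P[of j] by (auto simp: P_def)
    have ch: "(N j, \<phi> j) \<in> maximal_atlas A" by (rule maximal_atlas_restrict[OF A Nj(3,1,2)])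
    note cN = chartD[OF maximal_atlas_chart[OF ch]]
    \<comment> \<open>Exactly the coefficient of the squared norm in the weighted term
      \<open>(1/2)^j * f j\<close>.\<close>
    define \<epsilon> where "\<epsilon> = (1/2)^j * \<alpha> j"
    have "\<epsilon> > 0" using Nj(4) by (simp add: \<epsilon>_def)
    \<comment> \<open>The term \<open>j\<close> is replaced by 0 so that \<open>psh_series\<close>
      applies unchanged to the remaining ones.\<close>
    define G where "G = (\<lambda>i. if i = j then (\<lambda>_. 0) else f i)"
    have G: "\<And>j. continuous_on UNIV (G j)" "\<And>j y. \<bar>G j y\<bar> \<le> 1" "\<And>j. psh_on A UNIV (\<lambda>y. ereal (G j y))"
      using f psh_at_const[of A 0] by (auto simp: G_def psh_on_iff[OF A open_UNIV])
    define T where "T = (\<lambda>y. \<Sum>i. (1/2)^i * G i y)"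
    have Tprops: "continuous_on UNIV T" "psh_on A UNIV (\<lambda>y. ereal (T y))"
        "summable (\<lambda>i. (1/2)^i * G i y)" for y
      unfolding T_def by (rule psh_series[where F = G, OF A G])+
    have ST: "S y = T y + (1/2)^j * f j y" for y
    proof -
      have "(\<lambda>i. (1/2)^i * G i y) sums T y"
        unfolding T_def by (rule summable_sums[OF Tprops(3)])
      moreover have "(\<lambda>i. if i = j then (1/2)^i * f i y else 0) sums ((1/2)^j * f j y)"
        by (rule sums_single)
      ultimately have "(\<lambda>i. (1/2)^i * G i y + (if i = j then (1/2)^i * f i y else 0)) sums (T y + (1/2)^j * f j y)"
        by (rule sums_add)
      also have "(\<lambda>i. (1/2)^i * G i y + (if i = j then (1/2)^i * f i y else 0)) = (\<lambda>i. (1/2)^i * f i y)"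
        by (auto simp: G_def)
      finally show ?thesis unfolding S_def by (rule sums_unique[symmetric])
    qed
    define q where "q = \<phi> j w"
    \<comment> \<open>The weighted term \<open>j\<close> minus
      \<open>\<epsilon> * (norm (\<phi> j y - \<phi> j w))^2\<close>. The quadratic parts cancel
      although the centres \<open>p j\<close> and \<open>\<phi> j w\<close> may differ, which leaves
      an affine function.\<close>
    define l where "l = (\<lambda>y. ((1/2)^j * c j + \<epsilon> * ((norm (p j))\<^sup>2 - (norm q)\<^sup>2)) + \<phi> j y \<bullet> ((2 * \<epsilon>) *\<^sub>R (q - p j)))"
    have eq: "S y - \<epsilon> * (norm (\<phi> j y - \<phi> j w))\<^sup>2 = T y + l y" if "y \<in> N j" for y
      unfolding ST Nj(5)[OF that] l_def q_def[symmetric]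
      by (simp add: \<epsilon>_def power2_norm_eq_inner inner_simps inner_commute algebra_simps)
    have "psh_on A (N j) (\<lambda>z. ereal (S z) - ereal (\<epsilon> * (norm (\<phi> j z - \<phi> j w))\<^sup>2))"
      unfolding psh_on_iff[OF A Nj(1)]
    proof
      fix z assume z: "z \<in> N j"
      have "psh_at A (\<lambda>y. ereal (T y + l y)) z"
      proof (rule psh_at_add_minorant[OF Nj(1) z])
        show "continuous_on (N j) T" by (rule continuous_on_subset[OF Tprops(1)]) simp
        show "psh_at A (\<lambda>y. ereal (T y)) z" using Tprops(2) unfolding psh_on_iff[OF A open_UNIV] by simp
        show "continuous_on (N j) l" unfolding l_def by (intro continuous_intros cN)
        show "holomorphic_minorant A l z" unfolding l_def by (rule minorant_inner[OF A ch z])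
      qed
      moreover have "eventually (\<lambda>y. ereal (T y + l y) = ereal (S y) - ereal (\<epsilon> * (norm (\<phi> j y - \<phi> j w))\<^sup>2)) (nhds z)"
        unfolding eventually_nhds using Nj(1) z eq by (intro exI[of _ "N j"]) auto
      ultimately show "psh_at A (\<lambda>z. ereal (S z) - ereal (\<epsilon> * (norm (\<phi> j z - \<phi> j w))\<^sup>2)) z"
        by (rule psh_at_cong[rotated])
    qed
    then show "\<exists>(U, \<phi>)\<in>maximal_atlas A. w \<in> U \<and>
        (\<exists>\<epsilon>>0. psh_on A U (\<lambda>z. ereal (S z) - ereal (\<epsilon> * (norm (\<phi> z - \<phi> w))\<^sup>2)))"
      using ch j \<open>\<epsilon> > 0\<close> by (intro bexI[OF _ ch]) auto
  qed
  moreover have "bounded_fun (\<lambda>y. ereal (S y))"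
    unfolding bounded_fun_def using Sprops(3) by (intro exI[of _ 2]) simp
  moreover have "continuous_on UNIV (\<lambda>y. ereal (S y))"
    by (intro continuous_on_ereal Sprops)
  ultimately show ?thesis by blast
qed

section \<open>From a strictly plurisubharmonic function to the Green function\<close>

lemma norm_vector_scale: "norm (c *s (x::complex^'n)) = norm c * norm x"
  by (simp add: norm_vec_def norm_mult L2_set_right_distrib)

lemma elog_mono: "x \<le> y \<Longrightarrow> elog x \<le> elog y"
  by (auto simp: elog_def)

lemma elog_mult: "B > 0 \<Longrightarrow> elog (B * x) = elog x + ereal (ln B)"
  by (auto simp: elog_def mult_le_0_iff zero_less_mult_iff ln_mult)

text \<open>Each competitor brings its own chart. Differentiability of the transition at
  \<open>\<phi> w\<close> gives the bound \<open>K + 1\<close> on the ratio of the two coordinate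
  distances, which changes the constant by \<open>ln (K + 1)\<close>.\<close>

lemma log_pole_in_chart:
  assumes A: "complex_atlas A" and U: "(U, \<phi>) \<in> maximal_atlas A" "w \<in> U" and v: "log_pole A v w"
  shows "\<exists>\<eta>>0. \<exists>c. \<forall>y\<in>U. norm (\<phi> y - \<phi> w) < \<eta> \<longrightarrow> v y \<le> elog (norm (\<phi> y - \<phi> w)) + ereal c"
proof -
  obtain V \<psi> c where V: "(V, \<psi>) \<in> maximal_atlas A" "w \<in> V"
    "\<And>z. z \<in> V \<Longrightarrow> v z \<le> elog (norm (\<psi> z - \<psi> w)) + ereal c"
    using v unfolding log_pole_def by blast
  note chU = maximal_atlas_chart[OF U(1)]
  note cU = chartD[OF chU]
  have open1: "open (\<phi> ` (U \<inter> V))"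
    by (rule chart_open_image[OF chU chartD(1)[OF maximal_atlas_chart[OF V(1)]]])
  have wUV: "\<phi> w \<in> \<phi> ` (U \<inter> V)" using U V by auto
  obtain \<eta>1 where \<eta>1: "\<eta>1 > 0" "ball (\<phi> w) \<eta>1 \<subseteq> \<phi> ` (U \<inter> V)"
    using open1 wUV unfolding open_contains_ball by blast
  obtain D where D: "((\<psi> \<circ> inv_into U \<phi>) has_derivative D) (at (\<phi> w))"
    using holomorphic_transition[OF A U(1) V(1)] wUV unfolding holomorphic_map_on_def by blast
  then have "bounded_linear D" by (rule has_derivative_bounded_linear)
  then obtain K where K: "K > 0" "\<And>h. norm (D h) \<le> norm h * K"
    using bounded_linear.pos_bounded by blast
  obtain \<eta>2 where \<eta>2: "\<eta>2 > 0" "\<And>x. norm (x - \<phi> w) < \<eta>2 \<Longrightarrow>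
      norm ((\<psi> \<circ> inv_into U \<phi>) x - (\<psi> \<circ> inv_into U \<phi>) (\<phi> w) - D (x - \<phi> w)) \<le> 1 * norm (x - \<phi> w)"
    using D unfolding has_derivative_at_alt by (meson zero_less_one)
  have "v y \<le> elog (norm (\<phi> y - \<phi> w)) + ereal (ln (K + 1) + c)"
    if y: "y \<in> U" "norm (\<phi> y - \<phi> w) < min \<eta>1 \<eta>2" for y
  proof -
    have "\<phi> y \<in> \<phi> ` (U \<inter> V)" using \<eta>1(2) y by (auto simp: dist_norm norm_minus_commute)
    then have yV: "y \<in> V" using cU(3) y(1) by (auto simp: inj_on_def)
    have "norm (\<psi> y - \<psi> w - D (\<phi> y - \<phi> w)) \<le> norm (\<phi> y - \<phi> w)"
      using \<eta>2(2)[of "\<phi> y"] y cU(6)[OF y(1)] cU(6)[OF U(2)] by simp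
    moreover have "norm (\<psi> y - \<psi> w) \<le> norm (\<psi> y - \<psi> w - D (\<phi> y - \<phi> w)) + norm (D (\<phi> y - \<phi> w))"
      by (metis diff_add_cancel norm_triangle_ineq)
    ultimately have "norm (\<psi> y - \<psi> w) \<le> (K + 1) * norm (\<phi> y - \<phi> w)"
      using K(2)[of "\<phi> y - \<phi> w"] by (simp add: algebra_simps)
    then have "elog (norm (\<psi> y - \<psi> w)) \<le> elog ((K + 1) * norm (\<phi> y - \<phi> w))" by (rule elog_mono)
    also have "\<dots> = elog (norm (\<phi> y - \<phi> w)) + ereal (ln (K + 1))" using K(1) by (simp add: elog_mult)
    finally have "elog (norm (\<psi> y - \<psi> w)) + ereal c \<le> elog (norm (\<phi> y - \<phi> w)) + ereal (ln (K + 1)) + ereal c"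
      by (rule add_right_mono)
    with V(3)[OF yV] show ?thesis by (simp add: add.assoc)
  qed
  then show ?thesis using \<eta>1(1) \<eta>2(1) by (intro exI[of _ "min \<eta>1 \<eta>2"]) auto
qed

text \<open>
  Schwarz-type estimate on one disc: on \<open>\<eta>' \<le> |\<zeta>| \<le> r\<close> the function \<open>(1 - \<delta>) ln (|\<zeta>| / r)\<close>
  is harmonic, and the factor \<open>1 - \<delta>\<close> makes it dominate \<open>s\<close> on the inner circle for small \<open>\<eta>'\<close>.
\<close>

lemma subharmonic_log_pole_bound:
  assumes s: "subharmonic_on D s" "cball 0 r \<subseteq> D" "\<And>\<zeta>. s \<zeta> \<le> 0"
    and pole: "\<eta> > 0" "\<And>\<zeta>. 0 < norm \<zeta> \<Longrightarrow> norm \<zeta> < \<eta> \<Longrightarrow> norm \<zeta> \<le> r \<Longrightarrow> s \<zeta> \<le> ereal (ln (norm \<zeta>) + c)"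
    and z: "0 < norm z" "norm z < r"
  shows "s z \<le> ereal (ln (norm z) - ln r)"
proof -
  have r: "r > 0" using z by linarith
  have step: "s z \<le> ereal ((1 - \<delta>) * ln (norm z / r))" if \<delta>: "0 < \<delta>" "\<delta> < 1" for \<delta>
  proof -
    \<comment> \<open>The first two entries keep the inner circle in the range of the pole estimate
      and inside the circle through \<open>z\<close>. The third is the condition
      \<open>ln \<eta>' + c \<le> (1 - \<delta>) * ln (\<eta>' / r)\<close> solved for
      \<open>\<eta>'\<close>.\<close>
    define \<eta>' where "\<eta>' = Min {\<eta> / 2, norm z / 2, exp ((- c - (1 - \<delta>) * ln r) / \<delta>)}"
    have "0 < \<eta>'" "\<eta>' \<le> \<eta> / 2" "\<eta>' \<le> norm z / 2" "\<eta>' \<le> exp ((- c - (1 - \<delta>) * ln r) / \<delta>)"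
      using pole(1) z by (auto simp: \<eta>'_def)
    then have \<eta>': "0 < \<eta>'" "\<eta>' < \<eta>" "\<eta>' < norm z" "\<eta>' < r" "\<eta>' \<le> exp ((- c - (1 - \<delta>) * ln r) / \<delta>)"
      using pole(1) z by linarith+
    define K where "K = cball 0 r - ball (0::complex) \<eta>'"
    have "compact K" unfolding K_def by (intro compact_diff) auto
    have Kint: "{\<zeta>. \<eta>' < norm \<zeta> \<and> norm \<zeta> < r} \<subseteq> interior K"
    proof (rule interior_maximal)
      show "{\<zeta>. \<eta>' < norm \<zeta> \<and> norm \<zeta> < r} \<subseteq> K" by (auto simp: K_def)
      show "open {\<zeta>::complex. \<eta>' < norm \<zeta> \<and> norm \<zeta> < r}"
        by (intro open_Collect_conj open_Collect_less continuous_intros)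
    qed
    define h where "h = (\<lambda>\<zeta>::complex. (1 - \<delta>) * ln (norm \<zeta> / r))"
    have "s z \<le> ereal (h z)"
    proof (rule maximum_principle[OF s(1) \<open>compact K\<close>])
      show "K \<subseteq> D" using s(2) by (auto simp: K_def)
      show "continuous_on K h"
        unfolding h_def using \<eta>'(1) r by (intro continuous_intros) (auto simp: K_def)
      show "z \<in> K" using \<eta>' z by (auto simp: K_def)
      show "\<exists>\<rho>>0. \<exists>g. g holomorphic_on ball a \<rho> \<and> (\<forall>\<zeta>\<in>ball a \<rho>. h \<zeta> = Re (g \<zeta>))" if "a \<in> interior K" for a
      proof -
        have "a \<in> K" using that interior_subset by blast
        then have a: "norm a > 0" using \<eta>'(1) by (auto simp: K_def)
        have pos: "Re (\<zeta> / a) > 0" if "\<zeta> \<in> ball a (norm a)" for \<zeta>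
        proof -
          have "norm (1 - \<zeta> / a) = norm (a - \<zeta>) / norm a"
            using a by (simp add: diff_divide_distrib flip: norm_divide)
          also have "\<dots> < 1" using that a by (simp add: dist_norm)
          finally have "\<bar>Re (1 - \<zeta> / a)\<bar> < 1" using abs_Re_le_cmod le_less_trans by blast
          then show ?thesis by simp
        qed
        \<comment> \<open>Dividing by \<open>a\<close> moves the ball into the right half-plane,
          where the principal logarithm is holomorphic; the added constant restores
          \<open>ln (norm \<zeta> / r)\<close> in the real part.\<close>
        define g where "g = (\<lambda>\<zeta>. of_real (1 - \<delta>) * (Ln (\<zeta> / a) + of_real (ln (norm a / r))))"
        have "g holomorphic_on ball a (norm a)"
          unfolding g_def
        proof (intro holomorphic_intros)
          show "\<zeta> / a \<notin> \<real>\<^sub>\<le>\<^sub>0" if "\<zeta> \<in> ball a (norm a)" for \<zeta>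
            using pos[OF that] by (auto simp: complex_nonpos_Reals_iff)
        qed (use a in auto)
        moreover have "h \<zeta> = Re (g \<zeta>)" if "\<zeta> \<in> ball a (norm a)" for \<zeta>
        proof -
          have "\<zeta> \<noteq> 0" using pos[OF that] by auto
          then show ?thesis using a r
            by (simp add: h_def g_def norm_divide ln_div)
        qed
        ultimately show ?thesis using a by (intro exI[of _ "norm a"]) auto
      qed
      show "s \<zeta> \<le> ereal (h \<zeta>)" if "\<zeta> \<in> frontier K" for \<zeta>
      proof -
        have "\<zeta> \<in> K" "\<zeta> \<notin> interior K"
          using that \<open>compact K\<close> by (auto simp: frontier_def compact_imp_closed)
        moreover have "\<not> (\<eta>' < norm \<zeta> \<and> norm \<zeta> < r)"
          using Kint \<open>\<zeta> \<notin> interior K\<close> by blast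
        ultimately have "norm \<zeta> = \<eta>' \<or> norm \<zeta> = r" by (auto simp: K_def)
        then show ?thesis
        proof
          assume "norm \<zeta> = r"
          then show ?thesis using s(3)[of \<zeta>] r by (simp add: h_def zero_ereal_def)
        next
          assume n: "norm \<zeta> = \<eta>'"
          have "ln \<eta>' \<le> (- c - (1 - \<delta>) * ln r) / \<delta>"
            using \<eta>'(1,5) by (metis exp_le_cancel_iff exp_ln)
          then have "\<delta> * ln \<eta>' \<le> - c - (1 - \<delta>) * ln r"
            using \<delta> by (simp add: pos_le_divide_eq mult.commute)
          then have "ln \<eta>' + c \<le> (1 - \<delta>) * ln (\<eta>' / r)"
            using \<eta>'(1) r by (simp add: ln_div algebra_simps)
          moreover have "s \<zeta> \<le> ereal (ln (norm \<zeta>) + c)"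
            using n \<eta>' by (intro pole(2)) auto
          ultimately show ?thesis unfolding h_def n by (meson ereal_less_eq(3) order_trans)
        qed
      qed
    qed
    then show ?thesis by (simp add: h_def)
  qed
  define L where "L = ln (norm z / r)"
  have Leq: "L = ln (norm z) - ln r" using z r by (simp add: L_def ln_div)
  have "s z \<le> ereal L"
  proof (cases "s z")
    case (real y)
    have "y \<le> L"
    proof (rule field_le_epsilon)
      fix e :: real assume e: "e > 0"
      \<comment> \<open>Small enough that \<open>(1 - \<delta>) * L\<close> exceeds \<open>L\<close>
        by at most \<open>e\<close>.\<close>
      define \<delta> where "\<delta> = min (1/2) (e / (\<bar>L\<bar> + 1))"
      have \<delta>: "0 < \<delta>" "\<delta> < 1" "\<delta> \<le> e / (\<bar>L\<bar> + 1)" using e by (auto simp: \<delta>_def)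
      have "y \<le> (1 - \<delta>) * L" using step[OF \<delta>(1,2)] by (simp add: real L_def)
      moreover have "\<delta> * \<bar>L\<bar> \<le> e"
      proof -
        have "\<delta> * \<bar>L\<bar> \<le> \<delta> * (\<bar>L\<bar> + 1)" using \<delta> by simp
        also have "\<dots> \<le> e" using \<delta>(3) by (simp add: pos_le_divide_eq)
        finally show ?thesis .
      qed
      moreover have "- (\<delta> * L) \<le> \<delta> * \<bar>L\<bar>"
        using mult_left_mono[of "-L" "\<bar>L\<bar>" \<delta>] \<delta> by simp
      ultimately show "y \<le> L + e" by (simp add: algebra_simps)
    qed
    then show ?thesis by (simp add: real)
  next
    case PInf
    then show ?thesis using s(3)[of z] by simp
  qed simp
  then show ?thesis by (simp add: Leq)
qed

text \<open>The constants \<open>\<eta>\<close> and \<open>c\<close> of the pole depend on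
  \<open>v\<close>, but they disappear in the estimate on the line through \<open>\<phi> w\<close>
  and \<open>\<phi> z\<close>. The remaining \<open>- ln r\<close> depends on the chart only, so the
  bound survives the supremum over all \<open>v\<close>.\<close>

lemma log_pole_upper_bound:
  assumes A: "complex_atlas A" and U: "(U, \<phi>) \<in> maximal_atlas A" "w \<in> U" and r: "cball (\<phi> w) r \<subseteq> \<phi> ` U"
    and v: "psh_on A UNIV v" "\<And>z. v z < 0" "log_pole A v w"
    and z: "z \<in> U" "norm (\<phi> z - \<phi> w) < r"
  shows "v z \<le> elog (norm (\<phi> z - \<phi> w)) + ereal (- ln r)"
proof -
  note cU = chartD[OF maximal_atlas_chart[OF U(1)]]
  obtain \<eta> c where \<eta>: "\<eta> > 0" "\<And>y. y \<in> U \<Longrightarrow> norm (\<phi> y - \<phi> w) < \<eta> \<Longrightarrow>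
      v y \<le> elog (norm (\<phi> y - \<phi> w)) + ereal c"
    using log_pole_in_chart[OF A U v(3)] by blast
  show ?thesis
  proof (cases "z = w")
    case True
    then show ?thesis using \<eta>(2)[of w] \<eta>(1) U by (simp add: elog_def)
  next
    case False
    define R where "R = norm (\<phi> z - \<phi> w)"
    have "\<phi> z \<noteq> \<phi> w" using False cU(3) z U by (auto simp: inj_on_def)
    then have R: "R > 0" by (simp add: R_def)
    \<comment> \<open>A unit direction, so that \<open>norm \<zeta>\<close> is the coordinate
      distance to \<open>w\<close> along the line.\<close>
    define b where "b = of_real (1 / R) *s (\<phi> z - \<phi> w)"
    have nb: "norm (\<zeta> *s b) = norm \<zeta>" for \<zeta>
      unfolding b_def norm_vector_scale R_def[symmetric] using R by (simp add: norm_divide)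
    have Rb: "of_real R *s b = \<phi> z - \<phi> w"
      using R by (simp add: b_def vector_smult_assoc)
    define \<gamma> where "\<gamma> = (\<lambda>\<zeta>. inv_into U \<phi> (\<phi> w + \<zeta> *s b))"
    define D where "D = {\<zeta>. \<phi> w + \<zeta> *s b \<in> \<phi> ` (U \<inter> UNIV)}"
    have "subharmonic_on D (\<lambda>\<zeta>. (v \<circ> inv_into U \<phi>) (\<phi> w + \<zeta> *s b))"
      using v(1) U(1) unfolding psh_on_def psh_domain_def D_def by blast
    then have sub: "subharmonic_on D (\<lambda>\<zeta>. v (\<gamma> \<zeta>))" by (simp add: \<gamma>_def)
    have img: "\<phi> w + \<zeta> *s b \<in> \<phi> ` U" if "norm \<zeta> \<le> r" for \<zeta>
      using that r nb[of \<zeta>] by (auto simp: subset_iff dist_norm)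
    have "v (\<gamma> (of_real R)) \<le> ereal (ln (norm (of_real R :: complex)) - ln r)"
    proof (rule subharmonic_log_pole_bound[OF sub])
      show "cball 0 r \<subseteq> D" using img by (auto simp: D_def)
      show "v (\<gamma> \<zeta>) \<le> 0" for \<zeta> using v(2) less_imp_le by blast
      show "v (\<gamma> \<zeta>) \<le> ereal (ln (norm \<zeta>) + c)" if "0 < norm \<zeta>" "norm \<zeta> < \<eta>" "norm \<zeta> \<le> r" for \<zeta>
      proof -
        have "\<gamma> \<zeta> \<in> U" "\<phi> (\<gamma> \<zeta>) - \<phi> w = \<zeta> *s b"
          using img[OF that(3)] cU(7,8) by (simp_all add: \<gamma>_def)
        then have "v (\<gamma> \<zeta>) \<le> elog (norm \<zeta>) + ereal c"
          using \<eta>(2)[of "\<gamma> \<zeta>"] that nb by simp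
        then show ?thesis using that by (simp add: elog_def)
      qed
    qed (use R \<eta>(1) z in \<open>auto simp: R_def\<close>)
    moreover have "\<gamma> (of_real R) = z"
      unfolding \<gamma>_def Rb using cU(6)[OF z(1)] by simp
    ultimately show ?thesis using R by (simp add: elog_def flip: R_def)
  qed
qed

section \<open>A competitor with a strict pole\<close>

text \<open>The derivative \<open>1 / t - 2 * t / s^2\<close> is negative for
  \<open>t \<ge> s\<close>. The same comparison is made here with \<open>ln x \<le> x - 1\<close>,
  using \<open>s < x + y\<close>.\<close>

lemma ln_minus_power2_less:
  fixes x y s :: real
  assumes "0 < s" "s \<le> x" "x < y"
  shows "ln y - y\<^sup>2 / s\<^sup>2 < ln x - x\<^sup>2 / s\<^sup>2"
proof -
  have x: "0 < x" "0 < y" using assms by auto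
  have "ln y - ln x = ln (y / x)" using x by (simp add: ln_div)
  also have "\<dots> \<le> y / x - 1" using x by (intro ln_le_minus_one) simp
  also have "\<dots> = (y - x) / x" using x by (simp add: field_simps)
  also have "\<dots> \<le> (y - x) / s" using assms x by (intro divide_left_mono) auto
  also have "\<dots> = (y - x) * s / s\<^sup>2" using assms by (simp add: power2_eq_square)
  also have "\<dots> < (y - x) * (y + x) / s\<^sup>2"
    using assms by (intro divide_strict_right_mono mult_strict_left_mono) auto
  also have "\<dots> = y\<^sup>2 / s\<^sup>2 - x\<^sup>2 / s\<^sup>2"
    by (simp add: power2_eq_square algebra_simps diff_divide_distrib)
  finally show ?thesis by simp
qed

text \<open>
  With \<open>K = 1 / (\<epsilon> s\<^sup>2)\<close> the functions \<open>log \<rho> + K (u - \<epsilon> \<rho>\<^sup>2)\<close> and \<open>K u - C\<close>, where \<open>\<rho>\<close> is the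
  coordinate distance to \<open>w\<close>, differ by a function of \<open>\<rho>\<close> that strictly decreases for \<open>\<rho> \<ge> s\<close>.
  Choosing \<open>C\<close> so that it vanishes at \<open>\<rho> = m\<close>, switching from the first to the second at
  \<open>\<rho> = m\<close> is locally the same as taking their maximum.
\<close>

lemma exists_psh_with_strict_pole:
  fixes A :: "('m::{t2_space,second_countable_topology}, 'n::finite) chart set"
  assumes A: "complex_atlas A" and U: "(U, \<phi>) \<in> maximal_atlas A" "w \<in> U"
    and r: "r > 0" "cball (\<phi> w) r \<subseteq> \<phi> ` U"
    and f: "continuous_on UNIV f" "\<And>y. \<bar>f y\<bar> \<le> B" "psh_on A UNIV (\<lambda>y. ereal (f y))"
    and \<epsilon>: "\<epsilon> > 0" "psh_on A U (\<lambda>y. ereal (f y - \<epsilon> * (norm (\<phi> y - \<phi> w))\<^sup>2))"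
  shows "\<exists>v m c. psh_on A UNIV v \<and> (\<forall>y. v y < 0) \<and> log_pole A v w \<and> 0 < m \<and> m < r \<and>
    (\<forall>y\<in>U. norm (\<phi> y - \<phi> w) < m \<longrightarrow> elog (norm (\<phi> y - \<phi> w)) + ereal c \<le> v y)"
proof -
  note ch = maximal_atlas_chart[OF U(1)]
  note cU = chartD[OF ch]
  define R where "R = (\<lambda>y. norm (\<phi> y - \<phi> w))"
  have Req: "norm (\<phi> y - \<phi> w) = R y" for y by (simp add: R_def)
  have Rc: "continuous_on U R" unfolding R_def by (intro continuous_intros cU)
  have R0: "R y \<ge> 0" for y by (simp add: R_def)
  have Rw: "R y = 0 \<longleftrightarrow> y = w" if "y \<in> U" for y
    using that U(2) cU(3) by (auto simp: R_def inj_on_def)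
  have B: "B \<ge> 0" using f(2)[of w] by linarith
  \<comment> \<open>Only \<open>0 < s < m < r\<close> matters: the switch at \<open>m\<close> needs
    an annulus on both sides on which the difference of the branches is monotone.\<close>
  define s where "s = r / 2"
  define m where "m = 3 * r / 4"
  define K where "K = 1 / (\<epsilon> * s\<^sup>2)"
  define C where "C = m\<^sup>2 / s\<^sup>2 - ln m"
  \<comment> \<open>A common shift that makes both branches negative: \<open>K * B\<close> bounds
    \<open>K * f\<close>, \<open>\<bar>ln m\<bar>\<close> bounds the logarithm from above for
    \<open>R y < m\<close>, and \<open>\<bar>C\<bar>\<close> covers the outer branch.\<close>
  define L where "L = K * B + \<bar>ln m\<bar> + \<bar>C\<bar> + 1"
  have sm: "0 < s" "s < m" "m < r" "0 < m" using r by (auto simp: s_def m_def)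
  have K: "K > 0" using \<epsilon> sm by (simp add: K_def)
  have Ke: "K * (\<epsilon> * x) = x / s\<^sup>2" for x using \<epsilon> sm by (simp add: K_def)
  have Kf: "\<bar>K * f y\<bar> \<le> K * B" for y
    using f(2)[of y] K by (simp add: abs_mult)
  define q where "q = (\<lambda>y. K * (f y - \<epsilon> * (R y)\<^sup>2))"
  have q: "q y = K * f y - (R y)\<^sup>2 / s\<^sup>2" for y by (simp add: q_def right_diff_distrib Ke)
  have qc: "continuous_on U q"
    unfolding q_def by (intro continuous_intros Rc continuous_on_subset[OF f(1)]) auto
  define v1 where "v1 = (\<lambda>y. elog (R y) + ereal (q y - L))"
  define v2 where "v2 = (\<lambda>y. ereal (K * f y - C - L))"
  define v where "v = (\<lambda>y. if y \<in> U \<and> R y < m then v1 y else v2 y)"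
  have v1: "v1 y = ereal (ln (R y) + q y - L)" if "R y > 0" for y
    using that by (simp add: v1_def elog_def)
  have gt: "v2 y \<le> v1 y" if "s \<le> R y" "R y \<le> m" for y
  proof -
    have "ln m - m\<^sup>2 / s\<^sup>2 \<le> ln (R y) - (R y)\<^sup>2 / s\<^sup>2"
      using ln_minus_power2_less[OF sm(1) that(1), of m] that by (cases "R y = m") auto
    then show ?thesis using that sm v1[of y] by (simp add: v2_def q C_def)
  qed
  have lt: "v1 y \<le> v2 y" if "m \<le> R y" for y
  proof -
    have "ln (R y) - (R y)\<^sup>2 / s\<^sup>2 \<le> ln m - m\<^sup>2 / s\<^sup>2"
      using ln_minus_power2_less[OF sm(1), of m "R y"] that sm by (cases "R y = m") auto
    then show ?thesis using that sm v1[of y] by (simp add: v2_def q C_def)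
  qed
  define N1 where "N1 = {y \<in> U. R y < m}"
  define N2 where "N2 = {y \<in> U. s < R y} \<inter> {y \<in> U. R y < r}"
  define N3 where "N3 = - {y \<in> U. R y \<le> m}"
  have opens: "open N1" "open N2" "open N3"
    unfolding N1_def N2_def N3_def R_def using closed_coordinate_cball[OF ch r(2), of m] sm
    by (auto intro!: open_Int open_Compl open_Collect_less_on cU continuous_intros simp: open_closed)
  have v1up: "v1 y \<le> elog (R y) + ereal (K * B - L)" for y
  proof -
    have "0 \<le> (R y)\<^sup>2 / s\<^sup>2" by simp
    then have "q y \<le> K * B" using Kf[of y] unfolding q by linarith
    then show ?thesis by (simp add: v1_def add_left_mono)
  qed
  have vneg: "v y < 0" for y
  proof (cases "y \<in> U \<and> R y < m")
    case True
    have "elog (R y) < ereal \<bar>ln m\<bar> + ereal 1"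
    proof -
      have "m \<le> exp \<bar>ln m\<bar>" using sm(4) by (metis abs_ge_self exp_le_cancel_iff exp_ln)
      then have "R y < exp \<bar>ln m\<bar>" using True by simp
      then have "elog (R y) < ereal \<bar>ln m\<bar>" by (simp add: elog_less_ereal_iff)
      then show ?thesis by (cases "elog (R y)") auto
    qed
    then have "elog (R y) + ereal (K * B - L) < 0"
      by (cases "elog (R y)") (auto simp: L_def zero_ereal_def)
    then show ?thesis using True v1up[of y] by (simp add: v_def)
  next
    case False
    have "K * f y - C - L < 0" using Kf[of y] unfolding L_def by linarith
    then show ?thesis using False by (auto simp: v_def v2_def zero_ereal_def)
  qed
  have psh_v2: "psh_at A v2 z" for z
  proof -
    have "psh_at A (\<lambda>y. ereal (f y)) z" using f(3) unfolding psh_on_iff[OF A open_UNIV] by simp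
    from psh_at_cmult[OF open_UNIV UNIV_I f(1) this, of K]
    have "psh_at A (\<lambda>y. ereal (K * f y)) z" using K by simp
    from psh_at_add_minorant[OF open_UNIV UNIV_I _ this _ minorant_const[of A "- C - L" z]]
    have "psh_at A (\<lambda>y. ereal (K * f y + (- C - L))) z"
      by (simp add: continuous_intros f)
    also have "(\<lambda>y. ereal (K * f y + (- C - L))) = v2" by (simp add: v2_def fun_eq_iff)
    finally show ?thesis .
  qed
  have psh_v1: "psh_at A v1 z" if z: "z \<in> U" for z
  proof (cases "z = w")
    case True
    have "v1 z = -\<infinity>" using True by (simp add: v1_def R_def elog_def)
    moreover have "eventually (\<lambda>y. v1 y < ereal c) (nhds z)" for c
    proof -
      define N where "N = {y \<in> U. R y < exp (c - (K * B - L))}"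
      have "open N" unfolding N_def by (intro open_Collect_less_on cU Rc)
      moreover have "z \<in> N" using True U(2) by (simp add: N_def R_def)
      moreover have "v1 y < ereal c" if "y \<in> N" for y
      proof -
        have "elog (R y) < ereal (c - (K * B - L))"
          using that by (simp add: N_def elog_less_ereal_iff)
        then have "elog (R y) + ereal (K * B - L) < ereal c" by (cases "elog (R y)") auto
        with v1up[of y] show ?thesis by (rule le_less_trans)
      qed
      ultimately show ?thesis unfolding eventually_nhds by blast
    qed
    ultimately show ?thesis by (rule psh_at_MInfty)
  next
    case False
    \<comment> \<open>Away from \<open>w\<close> the branch \<open>v1\<close> is a sum of real
      functions: the continuous plurisubharmonic \<open>q\<close>, and \<open>ln (R y) - L\<close>,
      which has harmonic minorants.\<close>
    define N where "N = {y \<in> U. 0 < R y}"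
    have N: "open N" unfolding N_def by (intro open_Collect_less_on cU Rc)
    have zN: "z \<in> N" using False z Rw[OF z] R0[of z] by (simp add: N_def)
    have NU: "N \<subseteq> U" by (auto simp: N_def)
    have "psh_at A (\<lambda>y. ereal (f y - \<epsilon> * (R y)\<^sup>2)) z"
      using \<epsilon>(2) z unfolding psh_on_iff[OF A cU(1)] Req by simp
    moreover have "continuous_on U (\<lambda>y. f y - \<epsilon> * (R y)\<^sup>2)"
      by (intro continuous_intros Rc continuous_on_subset[OF f(1)]) auto
    ultimately have qp: "psh_at A (\<lambda>y. ereal (q y)) z"
      unfolding q_def using K by (intro psh_at_cmult[OF cU(1) z]) auto
    have "\<phi> z \<noteq> \<phi> w" using zN by (auto simp: N_def R_def)
    from minorant_ln_norm[OF A U(1) z this, of "- L"]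
    have lm: "holomorphic_minorant A (\<lambda>y. ln (R y) - L) z" unfolding Req by simp
    have "psh_at A (\<lambda>y. ereal (q y + (ln (R y) - L))) z"
    proof (rule psh_at_add_minorant[OF N zN _ qp _ lm])
      show "continuous_on N q" by (rule continuous_on_subset[OF qc NU])
      show "continuous_on N (\<lambda>y. ln (R y) - L)"
        by (intro continuous_intros continuous_on_subset[OF Rc NU]) (auto simp: N_def)
    qed
    moreover have "eventually (\<lambda>y. ereal (q y + (ln (R y) - L)) = v1 y) (nhds z)"
      unfolding eventually_nhds using N zN v1 by (intro exI[of _ N]) (auto simp: N_def)
    ultimately show ?thesis by (rule psh_at_cong[rotated])
  qed
  have "psh_at A v z" for z
  proof -
    \<comment> \<open>Inside \<open>N1\<close> and \<open>N3\<close> a single branch is in force;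
      the remaining points, with \<open>R z = m\<close>, lie in \<open>N2\<close>, where
      \<open>v\<close> is the maximum of both.\<close>
    consider "z \<in> N1" | "z \<in> N2" | "z \<in> N3"
    proof -
      have "R z < m \<or> s < R z \<and> R z < r \<or> \<not> R z \<le> m"
        using sm by linarith
      then show thesis
        using that by (auto simp: N1_def N2_def N3_def)
    qed
    then show ?thesis
    proof cases
      case 1
      then have "eventually (\<lambda>y. v1 y = v y) (nhds z)"
        unfolding eventually_nhds using opens(1) by (intro exI[of _ N1]) (auto simp: N1_def v_def)
      moreover have "psh_at A v1 z" using 1 by (intro psh_v1) (simp add: N1_def)
      ultimately show ?thesis by (rule psh_at_cong)
    next
      case 2
      have "max (v1 y) (v2 y) = v y" if "y \<in> N2" for y
        using that gt[of y] lt[of y] by (auto simp: N2_def v_def max_absorb1 max_absorb2)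
      then have "eventually (\<lambda>y. max (v1 y) (v2 y) = v y) (nhds z)"
        unfolding eventually_nhds using opens(2) 2 by blast
      moreover have "psh_at A v1 z" using 2 by (intro psh_v1) (simp add: N2_def)
      then have "psh_at A (\<lambda>y. max (v1 y) (v2 y)) z" using psh_v2 by (rule psh_at_max)
      ultimately show ?thesis by (rule psh_at_cong)
    next
      case 3
      then have "eventually (\<lambda>y. v2 y = v y) (nhds z)"
        unfolding eventually_nhds using opens(3) by (intro exI[of _ N3]) (auto simp: N3_def v_def)
      then show ?thesis using psh_v2 by (rule psh_at_cong)
    qed
  qed
  then have "psh_on A UNIV v" by (simp add: psh_on_iff[OF A open_UNIV])
  moreover have "log_pole A v w"
    unfolding log_pole_def
  proof (rule bexI[where x = "(N1, \<phi>)"], simp only: prod.case, intro conjI exI ballI)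
    show "(N1, \<phi>) \<in> maximal_atlas A"
      by (rule maximal_atlas_restrict[OF A U(1) opens(1)]) (auto simp: N1_def)
    show "w \<in> N1" using U sm by (simp add: N1_def R_def)
    show "v z \<le> elog (norm (\<phi> z - \<phi> w)) + ereal (K * B - L)" if "z \<in> N1" for z
      using that v1up[of z] unfolding Req by (simp add: N1_def v_def)
  qed
  moreover have "elog (R y) + ereal (- K * B - m\<^sup>2 / s\<^sup>2 - L) \<le> v y" if "y \<in> U" "R y < m" for y
  proof -
    have "(R y)\<^sup>2 \<le> m\<^sup>2" using that R0[of y] by (intro power_mono) auto
    then have "(R y)\<^sup>2 / s\<^sup>2 \<le> m\<^sup>2 / s\<^sup>2" by (intro divide_right_mono) auto
    then have "- K * B - m\<^sup>2 / s\<^sup>2 - L \<le> q y - L" using Kf[of y] by (simp add: q abs_le_iff)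
    then show ?thesis using that by (simp add: v_def v1_def add_left_mono)
  qed
  ultimately show ?thesis
    using vneg sm unfolding Req by blast
qed

text \<open>One competitor suffices for the lower bound, whereas the upper bound must hold for all
  of them with a common constant. Both estimates are available on the chart restricted to coordinate
  distance less than \<open>m\<close>.\<close>

lemma pluri_greenian_from_strictly_psh:
  fixes A :: "('m::{t2_space,second_countable_topology}, 'n::finite) chart set"
  assumes A: "complex_atlas A" and u: "bounded_fun u" "continuous_on UNIV u" "strictly_psh A u"
  shows "pluri_greenian A"
  unfolding pluri_greenian_def
proof
  fix w
  obtain B where B: "\<And>y. \<bar>u y\<bar> \<le> ereal B" using u(1) by (auto simp: bounded_fun_def)
  define f where "f = (\<lambda>y. real_of_ereal (u y))"
  have ufin: "\<bar>u y\<bar> \<noteq> \<infinity>" for y using B[of y] by auto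
  have uf: "u = (\<lambda>y. ereal (f y))" using ufin by (simp add: f_def ereal_real fun_eq_iff)
  have fc: "continuous_on UNIV f"
    using u(2) continuous_on_iff_real[of UNIV u] ufin by (simp add: f_def o_def)
  have fB: "\<bar>f y\<bar> \<le> B" for y using B[of y] by (simp add: uf)
  obtain U \<phi> \<epsilon> where U: "(U, \<phi>) \<in> maximal_atlas A" "w \<in> U" and \<epsilon>: "\<epsilon> > 0"
    "psh_on A U (\<lambda>z. u z - ereal (\<epsilon> * (norm (\<phi> z - \<phi> w))\<^sup>2))"
    using u(3) unfolding strictly_psh_def by blast
  note ch = maximal_atlas_chart[OF U(1)]
  note cU = chartD[OF ch]
  obtain r where r: "r > 0" "cball (\<phi> w) r \<subseteq> \<phi> ` U" using chart_contains_cball[OF ch U(2)] .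
  have fp: "psh_on A UNIV (\<lambda>y. ereal (f y))" using u(3) by (simp add: strictly_psh_def uf)
  have ep: "psh_on A U (\<lambda>y. ereal (f y - \<epsilon> * (norm (\<phi> y - \<phi> w))\<^sup>2))" using \<epsilon>(2) by (simp add: uf)
  obtain v m c where v: "psh_on A UNIV v" "\<And>y. v y < 0" "log_pole A v w" and m: "0 < m" "m < r"
    and low: "\<And>y. y \<in> U \<Longrightarrow> norm (\<phi> y - \<phi> w) < m \<Longrightarrow> elog (norm (\<phi> y - \<phi> w)) + ereal c \<le> v y"
    using exists_psh_with_strict_pole[OF A U r fc fB fp \<epsilon>(1) ep] by blast
  define N where "N = {y \<in> U. norm (\<phi> y - \<phi> w) < m}"
  have "open N" unfolding N_def by (intro open_Collect_less_on cU continuous_intros)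
  then have chN: "(N, \<phi>) \<in> maximal_atlas A"
    by (rule maximal_atlas_restrict[OF A U(1)]) (auto simp: N_def)
  show "strict_log_pole A (\<lambda>z. pluricomplex_green A z w) w"
    unfolding strict_log_pole_def
  proof (rule bexI[OF _ chN], simp only: prod.case, intro conjI exI ballI)
    show "w \<in> N" using U m by (simp add: N_def)
    fix z assume z: "z \<in> N"
    have "elog (norm (\<phi> z - \<phi> w)) + ereal c \<le> v z" using z low by (simp add: N_def)
    also have "\<dots> \<le> pluricomplex_green A z w"
      unfolding pluricomplex_green_def using v by (intro SUP_upper) simp
    finally show "elog (norm (\<phi> z - \<phi> w)) + ereal c \<le> pluricomplex_green A z w" .
    show "pluricomplex_green A z w \<le> elog (norm (\<phi> z - \<phi> w)) + ereal (- ln r)"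
      unfolding pluricomplex_green_def
    proof (rule SUP_least)
      fix v' assume "v' \<in> {u. psh_on A UNIV u \<and> (\<forall>x. u x < 0) \<and> log_pole A u w}"
      then show "v' z \<le> elog (norm (\<phi> z - \<phi> w)) + ereal (- ln r)"
        using z m by (intro log_pole_upper_bound[OF A U r(2)]) (auto simp: N_def)
    qed
  qed
qed

theorem theorem3p7:
  fixes A :: "('m::{t2_space,second_countable_topology}, 'n::finite) chart set"
  assumes "complex_atlas A"
    and "connected (UNIV :: 'm set)"
  shows "((\<exists>u. bounded_fun u \<and> continuous_on UNIV u \<and> strictly_psh A u) \<longrightarrow> pluri_greenian A) \<and>
         ((\<forall>w. \<exists>v. (\<forall>z. v z < 0) \<and> continuous_on UNIV v \<and> psh_on A UNIV v \<and> strict_log_pole A v w) \<longrightarrow>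
           (\<exists>u. bounded_fun u \<and> continuous_on UNIV u \<and> strictly_psh A u))"
  using pluri_greenian_from_strictly_psh[OF assms(1)] strictly_psh_from_strict_poles[OF assms(1)]
  by blast

end
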